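(* Let $\lambda\ge0$ and $n\in\mathbb Z_+$. For any $\Delta\in\mathcal O_c(X)$ we have $$\langle{:}\omega^{\otimes n}{:}_\lambda,\chi_\Delta^{\otimes n}\rangle=P^{(n)}_{\lambda,\Delta}(\langle\omega,\chi_\Delta\rangle)\qquad\text{for }\mu_\lambda\text{-a.a. }\omega\in\mathcal D',$$ where $(P^{(n)}_{\lambda,\Delta})_{n=0}^\infty$ are the polynomials on $\mathbb R$ with leading coefficient $1$ satisfying the recurrence relation $$xP^{(n)}_{\lambda,\Delta}(x)=P^{(n+1)}_{\lambda,\Delta}(x)+(\lambda n+c_\lambda\sigma(\Delta))P^{(n)}_{\lambda,\Delta}(x)+n(n-1+\sigma(\Delta))P^{(n-1)}_{\lambda,\Delta}(x),\qquad n\in\mathbb Z_+,$$ with $P^{(0)}_{\lambda,\Delta}=1$, $P^{(-1)}_{\lambda,\Delta}=0$.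
   Context: Setting. $X$ is a complete, connected, oriented, non-compact $C^\infty$ Riemannian manifold; $\sigma$ is a Radon measure on $(X,\mathcal B(X))$ that is non-atomic and non-degenerate ($\sigma(O)>0$ for every non-empty open $O$). $\mathcal O_c(X)$ is the set of open subsets of $X$ with compact closure; $\chi_\Delta$ is the indicator of $\Delta$. $\mathcal D=C_0^\infty(X)$ (real-valued, usual nuclear topology), $\mathcal H=L^2(X;\sigma)$, and $\mathcal D'$ is the dual of $\mathcal D$ with respect to the zero space $\mathcal H$, with dual pairing $\langle\cdot,\cdot\rangle$. The subscript $\mathbb C$ denotes complexification, $\hat\otimes$ the symmetric tensor power/product, $(\cdot)^\sim$ symmetrization, $\langle\xi\rangle:=\int_X\xi\,d\sigma$. Extended Fock space. Let $A_n$ be the set of collections $\alpha_n=\{\kappa_1,\dots,\kappa_{|\alpha_n|}\}$ of loops over $\{1,\dots,n\}$: the underlying sets of the loops partition $\{1,\dots,n\}$, and a loop is an ordering of its points up to cyclic permutation (so $A_n$ has $n!$ elements); $|\kappa_j|$ is the number of points of $\kappa_j$. For $f^{(n)}\in\mathcal D_{\mathbb C}^{\hat\otimes n}$ let $f^{(n)}_{\alpha_n}(x_1,\dots,x_{|\alpha_n|})=f^{(n)}(x_1,\dots,x_1,\dots,x_{|\alpha_n|},\dots,x_{|\alpha_n|})$, with $x_j$ repeated $|\kappa_j|$ times. $\mathcal F^{(n)}_{\mathrm{ext}}(\mathcal H)$ is the closure of $\mathcal D_{\mathbb C}^{\hat\otimes n}$ with respect to $(f^{(n)},g^{(n)})=\sum_{\alpha_n\in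 A_n}\int_{X^{|\alpha_n|}}(\overline{f^{(n)}}g^{(n)})_{\alpha_n}\,d\sigma^{\otimes|\alpha_n|}$, $\mathcal F^{(0)}_{\mathrm{ext}}=\mathbb C$, and $\mathcal F_{\mathrm{ext}}(\mathcal H)=\bigoplus_{n\ge0}\mathcal F^{(n)}_{\mathrm{ext}}(\mathcal H)\,n!$ (norm squared $\sum_n\|f^{(n)}\|^2n!$). $\mathcal F_{\mathrm{fin}}(\mathcal D)$ is the dense set of finite sequences with $f^{(n)}\in\mathcal D_{\mathbb C}^{\hat\otimes n}$; $\Omega=(1,0,0,\dots)$. The functions $\chi_\Delta^{\otimes n}$ belong to $\mathcal F^{(n)}_{\mathrm{ext}}(\mathcal H)$. Operators. For $\xi\in\mathcal D$, on $\mathcal F_{\mathrm{fin}}(\mathcal D)$: $a^+(\xi)f^{(n)}=\xi\hat\otimes f^{(n)}$; $(a^0(\xi)f^{(n)})(x_1,\dots,x_n)=n(\xi(x_1)f^{(n)}(x_1,\dots,x_n))^\sim$; $a^-(\xi)=a_1^-(\xi)+a_2^-(\xi)$ with $(a_1^-(\xi)f^{(n)})(x_1,\dots,x_{n-1})=n\int_X\xi(x)f^{(n)}(x,x_1,\dots,x_{n-1})\,\sigma(dx)$, $(a_2^-(\xi)f^{(n)})(x_1,\dots,x_{n-1})=n(n-1)(\xi(x_1)f^{(n)}(x_1,x_1,x_2,\dots,x_{n-1}))^\sim$. For $\lambda\ge0$, $a_\lambda(\xi)=a^+(\xi)+\lambda a^0(\xi)+a^-(\xi)+c_\lambda\langle\xi\rangle\mathrm{id}$,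 with $c_\lambda=\lambda/2$ for $\lambda\in[0,2]$ and $c_\lambda=2/(\lambda+\sqrt{\lambda^2-4})$ for $\lambda>2$. These operators are essentially selfadjoint in $\mathcal F_{\mathrm{ext}}(\mathcal H)$ with commuting closures $a_\lambda^\sim(\xi)$. $\mu_\lambda$ and $I_\lambda$ are the unique probability measure on $\mathcal D'$ with its cylinder $\sigma$-algebra and the unique unitary $I_\lambda:\mathcal F_{\mathrm{ext}}(\mathcal H)\to L^2(\mathcal D';\mu_\lambda)$ such that $I_\lambda\Omega=1$ and, for every $\xi\in\mathcal D$, $I_\lambda$ carries $a_\lambda^\sim(\xi)$ to multiplication by $\langle\cdot,\xi\rangle$. For $f^{(n)}\in\mathcal F^{(n)}_{\mathrm{ext}}(\mathcal H)$, $\langle{:}\cdot^{\otimes n}{:}_\lambda,f^{(n)}\rangle$ denotes the element $I_\lambda f^{(n)}$ of $L^2(\mathcal D';\mu_\lambda)$. The random variable $\langle\cdot,\chi_\Delta\rangle\in L^2(\mathcal D';\mu_\lambda)$ is defined by $\langle\omega,\chi_\Delta\rangle:=(I_\lambda\chi_\Delta)(\omega)+c_\lambda\sigma(\Delta)$. *)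

theory Defs
  imports
    "HOL-Analysis.Analysis"
    "HOL-Probability.Probability"
    "HOL-Combinatorics.Permutations"
    "HOL-Computational_Algebra.Polynomial"
begin

section \<open>Oriented Riemannian manifolds\<close>

text \<open>
  The manifold \<open>X\<close> is the whole type \<open>'x\<close> (Hausdorff, second countable), equipped with an atlas of
  charts \<open>(U, \<phi>)\<close> into the model space \<open>real ^ 'd\<close>; the values of \<open>\<phi>\<close> outside \<open>U\<close> are irrelevant.
\<close>

type_synonym ('x, 'd) chart = "'x set \<times> ('x \<Rightarrow> real ^ 'd)"

definition chart_inv :: "('x, 'd) chart \<Rightarrow> real ^ 'd \<Rightarrow> 'x" where
  "chart_inv c = inv_into (fst c) (snd c)"

fun iter_deriv :: "'e list \<Rightarrow> ('e::euclidean_space \<Rightarrow> 'b::real_normed_vector) \<Rightarrow> 'e \<Rightarrow> 'b" where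
  "iter_deriv [] f = f"
| "iter_deriv (v # vs) f = (\<lambda>u. frechet_derivative (iter_deriv vs f) (at u) v)"

text \<open>\<open>C\<^sup>\<infinity>\<close> on an open set: all iterated partial derivatives exist and are differentiable there.\<close>

definition smooth_fun_on :: "'e::euclidean_space set \<Rightarrow> ('e \<Rightarrow> 'b::real_normed_vector) \<Rightarrow> bool" where
  "smooth_fun_on W f \<longleftrightarrow> (\<forall>vs\<in>lists Basis. \<forall>u\<in>W. iter_deriv vs f differentiable (at u))"

definition transition :: "('x, 'd) chart \<Rightarrow> ('x, 'd) chart \<Rightarrow> real ^ 'd \<Rightarrow> real ^ 'd" where
  "transition c c' = snd c' \<circ> chart_inv c"

definition jacobian_at :: "(real ^ 'd::finite \<Rightarrow> real ^ 'd) \<Rightarrow> real ^ 'd \<Rightarrow> real ^ 'd ^ 'd" where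
  "jacobian_at h u = matrix (frechet_derivative h (at u))"

definition smooth_atlas ::
    "('x::{t2_space, second_countable_topology}, 'd::finite) chart set \<Rightarrow> bool" where
  "smooth_atlas A \<longleftrightarrow>
     (\<Union>c\<in>A. fst c) = UNIV \<and>
     (\<forall>c\<in>A. open (fst c) \<and> open (snd c ` fst c) \<and>
            homeomorphism (fst c) (snd c ` fst c) (snd c) (chart_inv c)) \<and>
     (\<forall>c\<in>A. \<forall>c'\<in>A. smooth_fun_on (snd c ` (fst c \<inter> fst c')) (transition c c'))"

definition oriented_atlas ::
    "('x::{t2_space, second_countable_topology}, 'd::finite) chart set \<Rightarrow> bool" where
  "oriented_atlas A \<longleftrightarrow> smooth_atlas A \<and>
     (\<forall>c\<in>A. \<forall>c'\<in>A. \<forall>u\<in>snd c ` (fst c \<inter> fst c'). det (jacobian_at (transition c c') u) > 0)"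

text \<open>\<open>G c p\<close> is the Gram matrix of the metric at the point \<open>p\<close> in the coordinates of the chart \<open>c\<close>.\<close>

definition riemannian_metric ::
    "('x::{t2_space, second_countable_topology}, 'd::finite) chart set \<Rightarrow>
     (('x, 'd) chart \<Rightarrow> 'x \<Rightarrow> real ^ 'd ^ 'd) \<Rightarrow> bool" where
  "riemannian_metric A G \<longleftrightarrow>
     (\<forall>c\<in>A. smooth_fun_on (snd c ` fst c) (G c \<circ> chart_inv c) \<and>
        (\<forall>p\<in>fst c. transpose (G c p) = G c p \<and> (\<forall>v. v \<noteq> 0 \<longrightarrow> v \<bullet> (G c p *v v) > 0))) \<and>
     (\<forall>c\<in>A. \<forall>c'\<in>A. \<forall>p\<in>fst c \<inter> fst c'.
        let J = jacobian_at (transition c c') (snd c p) in G c p = transpose J ** G c' p ** J)"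

text \<open>Continuous curves on the unit interval that are \<open>C\<^sup>1\<close> off a finite set; lengths may be infinite.\<close>

definition admissible_curve ::
    "('x::topological_space, 'd::finite) chart set \<Rightarrow> (real \<Rightarrow> 'x) \<Rightarrow> bool" where
  "admissible_curve A \<gamma> \<longleftrightarrow> continuous_on {0..1} \<gamma> \<and>
     (\<exists>S. finite S \<and>
        (\<forall>c\<in>A. (snd c \<circ> \<gamma>) C1_differentiable_on ({0<..<1} \<inter> \<gamma> -` fst c - S)))"

text \<open>For a Riemannian metric the speed does not depend on the chosen chart around \<open>\<gamma> t\<close>.\<close>

definition curve_speed ::
    "('x, 'd::finite) chart set \<Rightarrow> (('x, 'd) chart \<Rightarrow> 'x \<Rightarrow> real ^ 'd ^ 'd) \<Rightarrow>
     (real \<Rightarrow> 'x) \<Rightarrow> real \<Rightarrow> real" where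
  "curve_speed A G \<gamma> t =
     (let c = (SOME c. c \<in> A \<and> \<gamma> t \<in> fst c);
          v = vector_derivative (snd c \<circ> \<gamma>) (at t)
      in sqrt (v \<bullet> (G c (\<gamma> t) *v v)))"

definition curve_length ::
    "('x, 'd::finite) chart set \<Rightarrow> (('x, 'd) chart \<Rightarrow> 'x \<Rightarrow> real ^ 'd ^ 'd) \<Rightarrow>
     (real \<Rightarrow> 'x) \<Rightarrow> ennreal" where
  "curve_length A G \<gamma> = (\<integral>\<^sup>+t\<in>{0..1}. ennreal (curve_speed A G \<gamma> t) \<partial>lborel)"

definition riemannian_distance ::
    "('x::topological_space, 'd::finite) chart set \<Rightarrow>
     (('x, 'd) chart \<Rightarrow> 'x \<Rightarrow> real ^ 'd ^ 'd) \<Rightarrow> 'x \<Rightarrow> 'x \<Rightarrow> ennreal" where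
  "riemannian_distance A G p q =
     (INF \<gamma>\<in>{\<gamma>. admissible_curve A \<gamma> \<and> \<gamma> 0 = p \<and> \<gamma> 1 = q}. curve_length A G \<gamma>)"

text \<open>Completeness of the metric space \<open>X\<close>; by Hopf--Rinow this is the same as geodesic completeness.\<close>

definition riemannian_complete ::
    "('x::topological_space, 'd::finite) chart set \<Rightarrow>
     (('x, 'd) chart \<Rightarrow> 'x \<Rightarrow> real ^ 'd ^ 'd) \<Rightarrow> bool" where
  "riemannian_complete A G \<longleftrightarrow>
     (\<forall>s :: nat \<Rightarrow> 'x.
        (\<forall>e>0. \<exists>N. \<forall>m\<ge>N. \<forall>n\<ge>N. riemannian_distance A G (s m) (s n) < e) \<longrightarrow>
        (\<exists>l. (\<lambda>n. riemannian_distance A G (s n) l) \<longlonglongrightarrow> 0))"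

definition complete_oriented_riemannian_manifold ::
    "('x::{t2_space, second_countable_topology}, 'd::finite) chart set \<Rightarrow>
     (('x, 'd) chart \<Rightarrow> 'x \<Rightarrow> real ^ 'd ^ 'd) \<Rightarrow> bool" where
  "complete_oriented_riemannian_manifold A G \<longleftrightarrow>
     oriented_atlas A \<and> riemannian_metric A G \<and> riemannian_complete A G"


section \<open>The intensity measure\<close>

definition radon_measure :: "'x::topological_space measure \<Rightarrow> bool" where
  "radon_measure \<sigma> \<longleftrightarrow> sets \<sigma> = sets borel \<and>
     (\<forall>K. compact K \<longrightarrow> emeasure \<sigma> K < \<infinity>) \<and>
     (\<forall>B\<in>sets \<sigma>. emeasure \<sigma> B = (SUP K\<in>{K. compact K \<and> K \<subseteq> B}. emeasure \<sigma> K))"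

definition non_atomic :: "'x measure \<Rightarrow> bool" where
  "non_atomic \<sigma> \<longleftrightarrow>
     (\<forall>B\<in>sets \<sigma>. emeasure \<sigma> B > 0 \<longrightarrow>
        (\<exists>C\<in>sets \<sigma>. C \<subseteq> B \<and> 0 < emeasure \<sigma> C \<and> emeasure \<sigma> C < emeasure \<sigma> B))"

definition non_degenerate :: "'x::topological_space measure \<Rightarrow> bool" where
  "non_degenerate \<sigma> \<longleftrightarrow> (\<forall>U. open U \<and> U \<noteq> {} \<longrightarrow> emeasure \<sigma> U > 0)"

definition relatively_compact_open :: "'x::topological_space set set" where
  "relatively_compact_open = {U. open U \<and> compact (closure U)}"


section \<open>Test functions and generalized functions\<close>

definition test_funs ::
    "('x::topological_space, 'd::finite) chart set \<Rightarrow> ('x \<Rightarrow> real) set" where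
  "test_funs A = {f. compact (closure {x. f x \<noteq> 0}) \<and>
                    (\<forall>c\<in>A. smooth_fun_on (snd c ` fst c) (f \<circ> chart_inv c))}"

text \<open>
  The seminorm \<open>sup\<^sub>L |\<partial>\<^sup>\<alpha> f|\<close> in the coordinates of the chart \<open>c\<close>, for a compact set \<open>L\<close>
  inside its domain; 0 is inserted only for the case that \<open>L\<close> is empty.
\<close>

definition chart_seminorm ::
    "('x, 'd::finite) chart \<times> 'x set \<times> (real ^ 'd) list \<Rightarrow> ('x \<Rightarrow> real) \<Rightarrow> real" where
  "chart_seminorm k f = (case k of (c, L, vs) \<Rightarrow>
     Sup (insert 0 ((\<lambda>p. \<bar>iter_deriv vs (f \<circ> chart_inv c) (snd c p)\<bar>) ` L)))"

definition chart_seminorm_indices ::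
    "('x::topological_space, 'd::finite) chart set \<Rightarrow>
     (('x, 'd) chart \<times> 'x set \<times> (real ^ 'd) list) set" where
  "chart_seminorm_indices A =
     {(c, L, vs). c \<in> A \<and> compact L \<and> L \<subseteq> fst c \<and> vs \<in> lists Basis}"

text \<open>
  The usual nuclear topology of \<open>C\<^sub>0\<^sup>\<infinity>(X)\<close> is the locally convex inductive limit of the Frechet spaces
  of smooth functions supported in a fixed compact set \<open>K\<close>. Its continuous seminorms are
  exactly those whose restriction to each of these spaces is continuous.
\<close>

definition continuous_test_seminorm ::
    "('x::topological_space, 'd::finite) chart set \<Rightarrow> (('x \<Rightarrow> real) \<Rightarrow> real) \<Rightarrow> bool" where
  "continuous_test_seminorm A p \<longleftrightarrow>
     (\<forall>f\<in>test_funs A. \<forall>g\<in>test_funs A. p (\<lambda>x. f x + g x) \<le> p f + p g) \<and>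
     (\<forall>f\<in>test_funs A. \<forall>a. p (\<lambda>x. a * f x) = \<bar>a\<bar> * p f) \<and>
     (\<forall>K. compact K \<longrightarrow>
        (\<exists>F C. finite F \<and> F \<subseteq> chart_seminorm_indices A \<and>
           (\<forall>f\<in>test_funs A. {x. f x \<noteq> 0} \<subseteq> K \<longrightarrow> p f \<le> C * (\<Sum>k\<in>F. chart_seminorm k f))))"

definition test_topology ::
    "('x::topological_space, 'd::finite) chart set \<Rightarrow> ('x \<Rightarrow> real) topology" where
  "test_topology A = topology_generated_by
     {{g\<in>test_funs A. p (\<lambda>x. g x - f x) < r} | f p r.
        f \<in> test_funs A \<and> continuous_test_seminorm A p \<and> 0 < r}"

text \<open>
  \<open>\<D>'\<close> is the topological dual of \<open>\<D>\<close>; the dual pairing \<open>\<langle>\<omega>, \<xi>\<rangle>\<close> is evaluation \<open>\<omega> \<xi>\<close>.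
  Functionals are made extensional, so that they are determined by their values on \<open>\<D>\<close>.
\<close>

definition gen_funs ::
    "('x::topological_space, 'd::finite) chart set \<Rightarrow> (('x \<Rightarrow> real) \<Rightarrow> real) set" where
  "gen_funs A = {\<omega>\<in>extensional (test_funs A).
     (\<forall>f\<in>test_funs A. \<forall>g\<in>test_funs A. \<omega> (\<lambda>x. f x + g x) = \<omega> f + \<omega> g) \<and>
     (\<forall>f\<in>test_funs A. \<forall>a. \<omega> (\<lambda>x. a * f x) = a * \<omega> f) \<and>
     continuous_map (test_topology A) euclideanreal \<omega>}"

definition cylinder_algebra ::
    "('x::topological_space, 'd::finite) chart set \<Rightarrow> (('x \<Rightarrow> real) \<Rightarrow> real) set set" where
  "cylinder_algebra A = sigma_sets (gen_funs A)
     {{\<omega>\<in>gen_funs A. \<omega> \<xi> \<in> B} | \<xi> B. \<xi> \<in> test_funs A \<and> B \<in> sets borel}"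


section \<open>Symmetric smooth kernels\<close>

text \<open>
  A point of \<open>X\<^sup>n\<close> is an element of \<open>PiE {1..n} (\<lambda>_. UNIV)\<close>; the values of kernels at other arguments
  are irrelevant. For \<open>n = 0\<close> there is a single point, so that kernels are constants.
\<close>

abbreviation power_pts :: "nat \<Rightarrow> (nat \<Rightarrow> 'x) set" where
  "power_pts n \<equiv> PiE {1..n} (\<lambda>_. UNIV)"

type_synonym 'x kernel = "(nat \<Rightarrow> 'x) \<Rightarrow> complex"

fun iter_partial :: "(nat \<times> (real ^ 'd::finite)) list \<Rightarrow> ((nat \<Rightarrow> real ^ 'd) \<Rightarrow> complex) \<Rightarrow>
    (nat \<Rightarrow> real ^ 'd) \<Rightarrow> complex" where
  "iter_partial [] F = F"
| "iter_partial ((i, v) # ivs) F =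
     (\<lambda>u. vector_derivative (\<lambda>t. iter_partial ivs F (u(i := u i + t *\<^sub>R v))) (at 0))"

text \<open>\<open>C\<^sup>\<infinity>\<close> in \<open>n\<close> vector variables: all iterated partial derivatives exist and are continuous.\<close>

definition multi_smooth_on ::
    "nat \<Rightarrow> (nat \<Rightarrow> real ^ 'd::finite) set \<Rightarrow> ((nat \<Rightarrow> real ^ 'd) \<Rightarrow> complex) \<Rightarrow> bool" where
  "multi_smooth_on n W F \<longleftrightarrow>
     (\<forall>ivs\<in>lists ({1..n} \<times> Basis).
        continuous_on W (iter_partial ivs F) \<and>
        (\<forall>u\<in>W. \<forall>i\<in>{1..n}. \<forall>v\<in>Basis.
           (\<lambda>t. iter_partial ivs F (u(i := u i + t *\<^sub>R v))) differentiable (at (0::real))))"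

definition sym_kernel :: "nat \<Rightarrow> 'x kernel \<Rightarrow> bool" where
  "sym_kernel n f \<longleftrightarrow>
     (\<forall>\<pi>. \<pi> permutes {1..n} \<longrightarrow> (\<forall>x\<in>power_pts n. f (\<lambda>i\<in>{1..n}. x (\<pi> i)) = f x))"

definition symmetrize :: "nat \<Rightarrow> 'x kernel \<Rightarrow> 'x kernel" where
  "symmetrize n f x = (\<Sum>\<pi> | \<pi> permutes {1..n}. f (\<lambda>i\<in>{1..n}. x (\<pi> i))) / of_nat (fact n)"

text \<open>
  The \<open>n\<close>-th symmetric tensor power of the complexification of \<open>\<D>\<close> (a completed tensor power
  of a nuclear space), as the space of symmetric \<open>C\<^sup>\<infinity>\<close> functions on \<open>X\<^sup>n\<close> with compact support.
\<close>

definition test_kernels ::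
    "('x::topological_space, 'd::finite) chart set \<Rightarrow> nat \<Rightarrow> 'x kernel set" where
  "test_kernels A n = {f. sym_kernel n f \<and>
     (\<exists>K. compact K \<and> (\<forall>x\<in>power_pts n. f x \<noteq> 0 \<longrightarrow> x \<in> PiE {1..n} (\<lambda>_. K))) \<and>
     (\<forall>c. (\<forall>i\<in>{1..n}. c i \<in> A) \<longrightarrow>
        multi_smooth_on n (PiE {1..n} (\<lambda>i. snd (c i) ` fst (c i)))
          (\<lambda>u. f (\<lambda>i\<in>{1..n}. chart_inv (c i) (u i))))}"


section \<open>The extended Fock space\<close>

text \<open>
  A loop is a nonempty list of distinct points up to rotation, represented as the set of all rotations.
\<close>

definition loop_of :: "nat list \<Rightarrow> nat list set" where
  "loop_of xs = {rotate k xs | k. True}"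

definition loop_points :: "nat list set \<Rightarrow> nat set" where
  "loop_points \<kappa> = (\<Union>xs\<in>\<kappa>. set xs)"

definition loop_collections :: "nat \<Rightarrow> nat list set set set" where
  "loop_collections n = {\<alpha>.
     \<alpha> \<subseteq> loop_of ` {xs. xs \<noteq> [] \<and> distinct xs} \<and>
     disjoint_family_on loop_points \<alpha> \<and> (\<Union>\<kappa>\<in>\<alpha>. loop_points \<kappa>) = {1..n}}"

text \<open>
  The coordinates of the diagonal \<open>X\<^bsup>|\<alpha>|\<^esup>\<close> are indexed by the loops of \<open>\<alpha>\<close> themselves and \<open>y \<kappa>\<close> is
  inserted at the \<open>|\<kappa>|\<close> positions belonging to \<open>\<kappa>\<close>. As only symmetric kernels are considered, the
  order in which the repeated arguments are listed plays no role.
\<close>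

definition diagonal_restrict ::
    "nat \<Rightarrow> nat list set set \<Rightarrow> 'x kernel \<Rightarrow> (nat list set \<Rightarrow> 'x) \<Rightarrow> complex" where
  "diagonal_restrict n \<alpha> f y = f (\<lambda>i\<in>{1..n}. y (THE \<kappa>. \<kappa> \<in> \<alpha> \<and> i \<in> loop_points \<kappa>))"

definition ext_inner :: "'x measure \<Rightarrow> nat \<Rightarrow> 'x kernel \<Rightarrow> 'x kernel \<Rightarrow> complex" where
  "ext_inner \<sigma> n f g = (\<Sum>\<alpha>\<in>loop_collections n.
     integral\<^sup>L (PiM \<alpha> (\<lambda>_. \<sigma>)) (diagonal_restrict n \<alpha> (\<lambda>x. cnj (f x) * g x)))"

definition ext_norm :: "'x measure \<Rightarrow> nat \<Rightarrow> 'x kernel \<Rightarrow> real" where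
  "ext_norm \<sigma> n f = sqrt (Re (ext_inner \<sigma> n f f))"

definition ext_square_integrable :: "'x measure \<Rightarrow> nat \<Rightarrow> 'x kernel \<Rightarrow> bool" where
  "ext_square_integrable \<sigma> n f \<longleftrightarrow>
     f \<in> borel_measurable (PiM {1..n} (\<lambda>_. \<sigma>)) \<and>
     (\<forall>\<alpha>\<in>loop_collections n.
        integrable (PiM \<alpha> (\<lambda>_. \<sigma>)) (diagonal_restrict n \<alpha> (\<lambda>x. of_real ((cmod (f x))\<^sup>2) :: complex)))"

text \<open>
  The closure is realized inside the square-integrable symmetric functions on \<open>X\<^sup>n\<close> (the inner product
  is the \<open>L\<^sup>2\<close> product of the sum of the images of \<open>\<sigma>\<^bsup>\<otimes>|\<alpha>|\<^esup>\<close> on the diagonals). Elements are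
  representatives; two of them are equal in the Hilbert space when their difference has norm 0.
\<close>

definition ext_fock_n ::
    "('x::topological_space, 'd::finite) chart set \<Rightarrow> 'x measure \<Rightarrow> nat \<Rightarrow> 'x kernel set" where
  "ext_fock_n A \<sigma> n = {f. sym_kernel n f \<and> ext_square_integrable \<sigma> n f \<and>
     (\<forall>e>0. \<exists>g\<in>test_kernels A n. ext_norm \<sigma> n (\<lambda>x. f x - g x) < e)}"

type_synonym 'x fock_vec = "nat \<Rightarrow> 'x kernel"

definition ext_fock ::
    "('x::topological_space, 'd::finite) chart set \<Rightarrow> 'x measure \<Rightarrow> 'x fock_vec set" where
  "ext_fock A \<sigma> = {f. (\<forall>n. f n \<in> ext_fock_n A \<sigma> n) \<and>
                      summable (\<lambda>n. (ext_norm \<sigma> n (f n))\<^sup>2 * fact n)}"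

definition fock_inner :: "'x measure \<Rightarrow> 'x fock_vec \<Rightarrow> 'x fock_vec \<Rightarrow> complex" where
  "fock_inner \<sigma> f g = (\<Sum>n. ext_inner \<sigma> n (f n) (g n) * of_nat (fact n))"

definition fock_norm :: "'x measure \<Rightarrow> 'x fock_vec \<Rightarrow> real" where
  "fock_norm \<sigma> f = sqrt (\<Sum>n. (ext_norm \<sigma> n (f n))\<^sup>2 * fact n)"

definition fock_fin ::
    "('x::topological_space, 'd::finite) chart set \<Rightarrow> 'x fock_vec set" where
  "fock_fin A = {f. (\<forall>n. f n \<in> test_kernels A n) \<and>
                   (\<exists>N. \<forall>n>N. \<forall>x\<in>power_pts n. f n x = 0)}"

definition fock_embed :: "nat \<Rightarrow> 'x kernel \<Rightarrow> 'x fock_vec" where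
  "fock_embed n f = (\<lambda>m. if m = n then f else (\<lambda>_. 0))"

definition fock_vacuum :: "'x fock_vec" where
  "fock_vacuum = fock_embed 0 (\<lambda>_. 1)"

definition indicator_power :: "nat \<Rightarrow> 'x set \<Rightarrow> 'x kernel" where
  "indicator_power n S x = (\<Prod>i\<in>{1..n}. indicator S (x i))"


section \<open>The field operators\<close>

text \<open>\<open>prepend n z (x\<^sub>1, \<dots>, x\<^sub>n) = (z, x\<^sub>1, \<dots>, x\<^sub>n)\<close>\<close>

definition prepend :: "nat \<Rightarrow> 'x \<Rightarrow> (nat \<Rightarrow> 'x) \<Rightarrow> nat \<Rightarrow> 'x" where
  "prepend n z x = (\<lambda>i\<in>{1..Suc n}. if i = 1 then z else x (i - 1))"

text \<open>In the following operators \<open>n\<close> is the degree of the argument \<open>f\<close>.\<close>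

definition creation :: "('x \<Rightarrow> real) \<Rightarrow> nat \<Rightarrow> 'x kernel \<Rightarrow> 'x kernel" where
  "creation \<xi> n f =
     symmetrize (Suc n) (\<lambda>x. of_real (\<xi> (x 1)) * f (\<lambda>i\<in>{1..n}. x (Suc i)))"

definition neutral :: "('x \<Rightarrow> real) \<Rightarrow> nat \<Rightarrow> 'x kernel \<Rightarrow> 'x kernel" where
  "neutral \<xi> n f x = of_nat n * symmetrize n (\<lambda>x. of_real (\<xi> (x 1)) * f x) x"

definition annihilation1 :: "'x measure \<Rightarrow> ('x \<Rightarrow> real) \<Rightarrow> nat \<Rightarrow> 'x kernel \<Rightarrow> 'x kernel" where
  "annihilation1 \<sigma> \<xi> n f x =
     of_nat n * integral\<^sup>L \<sigma> (\<lambda>z. of_real (\<xi> z) * f (prepend (n - 1) z x))"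

definition annihilation2 :: "('x \<Rightarrow> real) \<Rightarrow> nat \<Rightarrow> 'x kernel \<Rightarrow> 'x kernel" where
  "annihilation2 \<xi> n f x = of_nat (n * (n - 1)) *
     symmetrize (n - 1) (\<lambda>x. of_real (\<xi> (x 1)) * f (prepend (n - 1) (x 1) x)) x"

definition c_lam :: "real \<Rightarrow> real" where
  "c_lam lam = (if lam \<le> 2 then lam / 2 else 2 / (lam + sqrt (lam\<^sup>2 - 4)))"

text \<open>The operator \<open>a\<^sub>\<lambda>(\<xi>)\<close>, written as the degree-\<open>n\<close> component of its value at \<open>f\<close>.\<close>

definition field_op ::
    "'x measure \<Rightarrow> real \<Rightarrow> ('x \<Rightarrow> real) \<Rightarrow> 'x fock_vec \<Rightarrow> 'x fock_vec" where
  "field_op \<sigma> lam \<xi> f n = (\<lambda>x.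
     (if n = 0 then 0 else creation \<xi> (n - 1) (f (n - 1)) x)
     + of_real lam * neutral \<xi> n (f n) x
     + (annihilation1 \<sigma> \<xi> (Suc n) (f (Suc n)) x + annihilation2 \<xi> (Suc n) (f (Suc n)) x)
     + of_real (c_lam lam * integral\<^sup>L \<sigma> \<xi>) * f n x)"

text \<open>The graph of the closure of \<open>a\<^sub>\<lambda>(\<xi>)\<close>, initially defined on the finite test vectors.\<close>

definition field_op_closure ::
    "('x::topological_space, 'd::finite) chart set \<Rightarrow> 'x measure \<Rightarrow> real \<Rightarrow> ('x \<Rightarrow> real) \<Rightarrow>
     ('x fock_vec \<times> 'x fock_vec) set" where
  "field_op_closure A \<sigma> lam \<xi> = {(f, g). f \<in> ext_fock A \<sigma> \<and> g \<in> ext_fock A \<sigma> \<and>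
     (\<forall>e>0. \<exists>h\<in>fock_fin A.
        fock_norm \<sigma> (\<lambda>n x. f n x - h n x) < e \<and>
        fock_norm \<sigma> (\<lambda>n x. g n x - field_op \<sigma> lam \<xi> h n x) < e)}"


section \<open>The spectral measure and the unitary\<close>

definition L2_funs :: "'w measure \<Rightarrow> ('w \<Rightarrow> complex) set" where
  "L2_funs \<mu> = {F. F \<in> borel_measurable \<mu> \<and> integrable \<mu> (\<lambda>\<omega>. (cmod (F \<omega>))\<^sup>2)}"

text \<open>
  Unitary operators from the extended Fock space onto \<open>L\<^sup>2(\<mu>)\<close>, acting on representatives:
  equality in \<open>L\<^sup>2(\<mu>)\<close> is equality almost everywhere.
\<close>

definition fock_unitary ::
    "('x::topological_space, 'd::finite) chart set \<Rightarrow> 'x measure \<Rightarrow> 'w measure \<Rightarrow>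
     ('x fock_vec \<Rightarrow> 'w \<Rightarrow> complex) \<Rightarrow> bool" where
  "fock_unitary A \<sigma> \<mu> I \<longleftrightarrow>
     (\<forall>f\<in>ext_fock A \<sigma>. I f \<in> L2_funs \<mu>) \<and>
     (\<forall>f\<in>ext_fock A \<sigma>. \<forall>g\<in>ext_fock A \<sigma>.
        AE \<omega> in \<mu>. I (\<lambda>n x. f n x + g n x) \<omega> = I f \<omega> + I g \<omega>) \<and>
     (\<forall>f\<in>ext_fock A \<sigma>. \<forall>a. AE \<omega> in \<mu>. I (\<lambda>n x. a * f n x) \<omega> = a * I f \<omega>) \<and>
     (\<forall>f\<in>ext_fock A \<sigma>. \<forall>g\<in>ext_fock A \<sigma>.
        integral\<^sup>L \<mu> (\<lambda>\<omega>. cnj (I f \<omega>) * I g \<omega>) = fock_inner \<sigma> f g) \<and>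
     (\<forall>F\<in>L2_funs \<mu>. \<exists>f\<in>ext_fock A \<sigma>. AE \<omega> in \<mu>. I f \<omega> = F \<omega>)"

text \<open>
  The last condition says that \<open>I\<close> maps the graph of the closure of \<open>a\<^sub>\<lambda>(\<xi>)\<close> onto the graph of
  multiplication by \<open>\<langle>\<cdot>, \<xi>\<rangle>\<close> on its maximal domain.
\<close>

definition spectral_pair ::
    "('x::topological_space, 'd::finite) chart set \<Rightarrow> 'x measure \<Rightarrow> real \<Rightarrow>
     (('x \<Rightarrow> real) \<Rightarrow> real) measure \<Rightarrow>
     ('x fock_vec \<Rightarrow> (('x \<Rightarrow> real) \<Rightarrow> real) \<Rightarrow> complex) \<Rightarrow> bool" where
  "spectral_pair A \<sigma> lam \<mu> I \<longleftrightarrow>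
     prob_space \<mu> \<and> space \<mu> = gen_funs A \<and> sets \<mu> = cylinder_algebra A \<and>
     fock_unitary A \<sigma> \<mu> I \<and>
     (AE \<omega> in \<mu>. I fock_vacuum \<omega> = 1) \<and>
     (\<forall>\<xi>\<in>test_funs A. \<forall>f\<in>ext_fock A \<sigma>. \<forall>g\<in>ext_fock A \<sigma>.
        (f, g) \<in> field_op_closure A \<sigma> lam \<xi> \<longleftrightarrow>
        (AE \<omega> in \<mu>. of_real (\<omega> \<xi>) * I f \<omega> = I g \<omega>))"

definition wick ::
    "('x fock_vec \<Rightarrow> 'w \<Rightarrow> complex) \<Rightarrow> nat \<Rightarrow> 'x kernel \<Rightarrow> 'w \<Rightarrow> complex" where
  "wick I n f = I (fock_embed n f)"

definition pair_indicator ::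
    "('x fock_vec \<Rightarrow> 'w \<Rightarrow> complex) \<Rightarrow> 'x measure \<Rightarrow> real \<Rightarrow> 'x set \<Rightarrow> 'w \<Rightarrow> complex" where
  "pair_indicator I \<sigma> lam S \<omega> =
     I (fock_embed 1 (indicator_power 1 S)) \<omega> + of_real (c_lam lam * measure \<sigma> S)"

end

theory Submission
  imports Defs
begin

text \<open>
  Write \<open>\<chi>\<close> for the indicator of \<open>\<Delta>\<close> and \<open>s = \<sigma>(\<Delta>)\<close>. For a test function \<open>\<xi>\<close>, the field operator maps
  \<open>\<xi>\<^sup>\<otimes>\<^sup>n\<close> to a combination of symmetrized products in which at most one factor \<open>\<xi>\<close> is replaced by
  \<open>\<xi>\<^sup>2\<close> or \<open>\<xi>\<^sup>3\<close>, with coefficients that involve the integrals of \<open>\<xi>\<close> and \<open>\<xi>\<^sup>2\<close> (\<open>field_op_power\<close>). If \<open>\<xi>\<close> could be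
  taken to be \<open>\<chi>\<close>, the powers would collapse because \<open>\<chi>\<^sup>2 = \<chi>\<close>, and the image would be
  \<open>\<chi>\<^bsup>\<otimes>(n+1)\<^esup> + (\<lambda>n + c\<^sub>\<lambda>s) \<chi>\<^sup>\<otimes>\<^sup>n + n(n - 1 + s) \<chi>\<^bsup>\<otimes>(n-1)\<^esup>\<close> (\<open>field_image_indicator\<close>),
  which is exactly the recurrence of the polynomials.

  As \<open>\<chi>\<close> is not a test function, the identity is reached as a limit. Test functions
  \<open>0 \<le> \<xi>\<^sub>k \<le> \<chi>\<close> converge to \<open>\<chi>\<close> pointwise (\<open>test_funs_approx_indicator\<close>), so by dominated convergence
  on every diagonal both \<open>\<xi>\<^sub>k\<^sup>\<otimes>\<^sup>n\<close> and its image converge in the extended Fock space to the expressions in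
  \<open>\<chi>\<close> (\<open>ext_norm_sq_power_tendsto\<close>, \<open>ext_norm_sq_field_image_tendsto\<close>). For each \<open>k\<close> the spectral representation
  turns the operator into multiplication by \<open>\<langle>\<omega>, \<xi>\<^sub>k\<rangle>\<close>; the case \<open>n = 0\<close>, where \<open>\<xi>\<^sub>k\<^sup>\<otimes>\<^sup>0\<close> is the vacuum,
  shows that this multiplier is itself the image of a Fock vector and hence converges to
  \<open>\<langle>\<omega>, \<chi>\<rangle>\<close> in \<open>L\<^sup>2\<close>. A product of two \<open>L\<^sup>2\<close>-convergent sequences need not converge in \<open>L\<^sup>2\<close>, but along a
  subsequence all three sequences converge almost everywhere, and there the product passes to the limit
  (\<open>field_limit_product\<close>). This gives the recurrence for the random variables
  \<open>\<langle>:\<omega>\<^sup>\<otimes>\<^sup>n:, \<chi>\<^sup>\<otimes>\<^sup>n\<rangle>\<close> (\<open>wick_recurrence\<close>), and induction on \<open>n\<close> identifies them with the polynomials.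
\<close>

section \<open>Smooth functions\<close>

lemma iter_deriv_snoc:
  "iter_deriv (vs @ [v]) f = iter_deriv vs (\<lambda>u. frechet_derivative f (at u) v)"
  by (induction vs) simp_all

text \<open>
  Smoothness, unfolded from the innermost derivative: one asks for the first derivatives and
  then for the smoothness of these. The definition by iterated derivatives
  differentiates on the outside, which is awkward for the product and chain rules; here both follow
  by induction on the order. The two notions agree by \<open>smooth_fun_on_iff_diff_upto\<close>.
\<close>

primrec diff_upto :: "nat \<Rightarrow> 'e::euclidean_space set \<Rightarrow> ('e \<Rightarrow> real) \<Rightarrow> bool" where
  "diff_upto 0 W f \<longleftrightarrow> True"
| "diff_upto (Suc k) W f \<longleftrightarrow> (\<forall>u\<in>W. f differentiable (at u)) \<and>
     (\<forall>v\<in>Basis. diff_upto k W (\<lambda>u. frechet_derivative f (at u) v))"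

lemma diff_upto_cong:
  assumes "open W" "\<And>u. u \<in> W \<Longrightarrow> f u = g u" "diff_upto k W f"
  shows "diff_upto k W g"
  using assms(2,3)
proof (induction k arbitrary: f g)
  case (Suc k)
  have der: "(g has_derivative frechet_derivative f (at u)) (at u)" if "u \<in> W" for u
  proof (rule has_derivative_transform_within_open[OF _ \<open>open W\<close> that])
    show "(f has_derivative frechet_derivative f (at u)) (at u)"
      using Suc.prems(2) that by (simp add: frechet_derivative_works)
  qed (rule Suc.prems(1))
  have "frechet_derivative f (at u) v = frechet_derivative g (at u) v" if "u \<in> W" for u v
    using frechet_derivative_at[OF der[OF that]] by simp
  then have "diff_upto k W (\<lambda>u. frechet_derivative g (at u) v)" if "v \<in> Basis" for v
    using Suc.IH[of "\<lambda>u. frechet_derivative f (at u) v"] Suc.prems(2) that by simp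
  moreover have "g differentiable (at u)" if "u \<in> W" for u
    using der[OF that] by (rule differentiableI)
  ultimately show ?case by simp
qed simp

lemma diff_upto_SucI:
  assumes "open W" "\<And>u. u \<in> W \<Longrightarrow> (f has_derivative f' u) (at u)"
    "\<And>v. v \<in> Basis \<Longrightarrow> diff_upto k W (\<lambda>u. f' u v)"
  shows "diff_upto (Suc k) W f"
proof -
  have "diff_upto k W (\<lambda>u. frechet_derivative f (at u) v)" if "v \<in> Basis" for v
    by (rule diff_upto_cong[OF assms(1) _ assms(3)[OF that]])
       (simp add: frechet_derivative_at[OF assms(2), symmetric])
  moreover have "f differentiable (at u)" if "u \<in> W" for u
    using assms(2)[OF that] by (rule differentiableI)
  ultimately show ?thesis by simp
qed

lemma diff_upto_Suc_deriv:
  assumes "diff_upto (Suc k) W f"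
  shows "u \<in> W \<Longrightarrow> (f has_derivative frechet_derivative f (at u)) (at u)"
    and "v \<in> Basis \<Longrightarrow> diff_upto k W (\<lambda>u. frechet_derivative f (at u) v)"
  using assms by (simp_all add: frechet_derivative_works[symmetric])

lemma diff_upto_SucD: "diff_upto (Suc k) W f \<Longrightarrow> diff_upto k W f"
  by (induction k arbitrary: f) auto

lemma diff_upto_const:
  assumes "open W" shows "diff_upto k W (\<lambda>_. c)"
proof (induction k arbitrary: c)
  case (Suc k)
  show ?case
    by (rule diff_upto_SucI[OF assms, of _ "\<lambda>_ _. 0"]) (auto intro: Suc)
qed simp

lemma diff_upto_add:
  assumes "open W" "diff_upto k W f" "diff_upto k W g"
  shows "diff_upto k W (\<lambda>u. f u + g u)"
  using assms(2,3)
proof (induction k arbitrary: f g)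
  case (Suc k)
  define f' where fold_f: "f' u = frechet_derivative f (at u)" for u
  note f' = diff_upto_Suc_deriv[OF Suc.prems(1), folded fold_f]
  define g' where fold_g: "g' u = frechet_derivative g (at u)" for u
  note g' = diff_upto_Suc_deriv[OF Suc.prems(2), folded fold_g]
  show ?case
    by (rule diff_upto_SucI[OF assms(1), of _ "\<lambda>u v. f' u v + g' u v"])
       (use f' g' Suc.IH in \<open>auto intro: has_derivative_add\<close>)
qed simp

lemma diff_upto_mult:
  assumes "open W" "diff_upto k W f" "diff_upto k W g"
  shows "diff_upto k W (\<lambda>u. f u * g u)"
  using assms(2,3)
proof (induction k arbitrary: f g)
  case (Suc k)
  define f' where fold_f: "f' u = frechet_derivative f (at u)" for u
  note f' = diff_upto_Suc_deriv[OF Suc.prems(1), folded fold_f]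
  define g' where fold_g: "g' u = frechet_derivative g (at u)" for u
  note g' = diff_upto_Suc_deriv[OF Suc.prems(2), folded fold_g]
  show ?case
    by (rule diff_upto_SucI[OF assms(1), of _ "\<lambda>u v. f u * g' u v + f' u v * g u"])
       (use f' g' Suc.prems[THEN diff_upto_SucD] in
         \<open>auto intro!: has_derivative_mult diff_upto_add[OF assms(1)] Suc.IH\<close>)
qed simp

text \<open>
  The outer function is given together with all its derivatives \<open>\<phi> n\<close>, because the derivative of the
  composition contains \<open>\<phi> (Suc n)\<close>; the induction is therefore over all \<open>n\<close> at once.
\<close>

lemma diff_upto_compose_real:
  assumes "open W" and \<phi>: "\<And>n t. (\<phi> n has_real_derivative \<phi> (Suc n) t) (at t)"
    and "diff_upto k W q"
  shows "diff_upto k W (\<lambda>u. \<phi> n (q u))"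
  using assms(3)
proof (induction k arbitrary: n)
  case (Suc k)
  define q' where fold_q: "q' u = frechet_derivative q (at u)" for u
  note q' = diff_upto_Suc_deriv[OF Suc.prems, folded fold_q]
  show ?case
  proof (rule diff_upto_SucI[OF assms(1), of _ "\<lambda>u v. \<phi> (Suc n) (q u) * q' u v"])
    fix u assume "u \<in> W"
    show "((\<lambda>u. \<phi> n (q u)) has_derivative (\<lambda>v. \<phi> (Suc n) (q u) * q' u v)) (at u)"
      using has_derivative_compose[OF q'(1)[OF \<open>u \<in> W\<close>] \<phi>[unfolded has_field_derivative_def]]
      by simp
  qed (use q' Suc.IH[OF diff_upto_SucD[OF Suc.prems]] in \<open>auto intro: diff_upto_mult[OF assms(1)]\<close>)
qed simp

lemma smooth_fun_on_deriv:
  assumes "smooth_fun_on W f"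
  shows "\<And>u. u \<in> W \<Longrightarrow> f differentiable (at u)"
    and "\<And>v. v \<in> Basis \<Longrightarrow> smooth_fun_on W (\<lambda>u. frechet_derivative f (at u) v)"
proof -
  show "f differentiable (at u)" if "u \<in> W" for u
    using assms that unfolding smooth_fun_on_def by (auto dest: bspec[where x="[]"])
  show "smooth_fun_on W (\<lambda>u. frechet_derivative f (at u) v)" if "v \<in> Basis" for v
    unfolding smooth_fun_on_def
  proof (intro ballI)
    fix vs :: "'a list" and u assume "vs \<in> lists Basis" "u \<in> W"
    then have "vs @ [v] \<in> lists Basis" using that by auto
    then have "iter_deriv (vs @ [v]) f differentiable at u"
      using assms \<open>u \<in> W\<close> unfolding smooth_fun_on_def by blast
    then show "iter_deriv vs (\<lambda>u. frechet_derivative f (at u) v) differentiable at u"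
      by (simp add: iter_deriv_snoc)
  qed
qed

text \<open>
  Coordinate changes are smooth as vector-valued maps, whereas \<open>diff_upto\<close> speaks of real functions;
  the components of a smooth map inherit smoothness since inner products commute with derivatives.
\<close>

lemma diff_upto_component:
  assumes "open W" "smooth_fun_on W h"
  shows "diff_upto k W (\<lambda>u. h u \<bullet> j)"
  using assms(2)
proof (induction k arbitrary: h)
  case (Suc k)
  show ?case
    by (rule diff_upto_SucI[OF assms(1), of _ "\<lambda>u v. frechet_derivative h (at u) v \<bullet> j"])
       (use Suc smooth_fun_on_deriv[OF Suc.prems] in
         \<open>auto intro: has_derivative_inner_left simp: frechet_derivative_works[symmetric]\<close>)
qed simp

lemma smooth_fun_on_iff_diff_upto:
  assumes "open W"
  shows "smooth_fun_on W f \<longleftrightarrow> (\<forall>k. diff_upto k W f)"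
proof
  assume "smooth_fun_on W f"
  then show "\<forall>k. diff_upto k W f"
    using diff_upto_component[OF assms, of f _ 1] by simp
next
  assume *: "\<forall>k. diff_upto k W f"
  have "\<forall>u\<in>W. iter_deriv vs f differentiable (at u)" if "vs \<in> lists Basis" for vs
    using that *
  proof (induction vs arbitrary: f rule: rev_induct)
    case Nil
    then have "diff_upto (Suc 0) W f" by blast
    then show ?case by simp
  next
    case (snoc v vs)
    have "diff_upto k W (\<lambda>u. frechet_derivative f (at u) v)" for k
    proof -
      have "diff_upto (Suc k) W f" using snoc.prems by blast
      then show ?thesis using snoc.prems(1) by simp
    qed
    with snoc show ?case by (simp add: iter_deriv_snoc)
  qed
  then show "smooth_fun_on W f" by (simp add: smooth_fun_on_def)
qed

section \<open>A flat function\<close>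

text \<open>
  For \<open>p = 1\<close> this is the classical smooth function \<open>exp (-1/t)\<close> that vanishes to infinite order at \<open>0\<close>.
  The polynomial in \<open>1/t\<close> is there because derivatives of this function have exactly this shape, so that
  the whole family is closed under differentiation.
\<close>

definition flat :: "real poly \<Rightarrow> real \<Rightarrow> real" where
  "flat p t = (if t > 0 then poly p (inverse t) * exp (- inverse t) else 0)"

definition flat_step :: "real poly \<Rightarrow> real poly" where
  "flat_step p = [:0, 0, 1:] * (p - pderiv p)"

lemma poly_exp_tendsto_0: "((\<lambda>s. poly p s * exp (- s)) \<longlongrightarrow> 0) at_top" for p :: "real poly"
proof -
  have "((\<lambda>s. \<Sum>i\<le>degree p. coeff p i * (s ^ i / exp s)) \<longlongrightarrow> (\<Sum>i\<le>degree p. coeff p i * 0)) at_top"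
    by (intro tendsto_intros tendsto_power_div_exp_0)
  then show ?thesis
    by (simp add: poly_altdef sum_distrib_right sum_divide_distrib exp_minus field_simps)
qed

lemma flat_has_derivative: "(flat p has_real_derivative flat (flat_step p) t) (at t)"
proof -
  consider "t > 0" | "t < 0" | "t = 0" by linarith
  then show ?thesis
  proof cases
    case 1
    have "((\<lambda>t. poly p (inverse t) * exp (- inverse t)) has_real_derivative flat (flat_step p) t) (at t)"
      using 1 by (auto intro!: derivative_eq_intros simp: flat_def flat_step_def power2_eq_square algebra_simps)
    then show ?thesis
      by (rule DERIV_cong_ev[THEN iffD1, rotated -1])
        (use eventually_nhds_in_open[of "{0<..}" t] 1 in
          \<open>auto simp: flat_def elim!: eventually_mono\<close>)
  next
    case 2
    have "((\<lambda>t. 0) has_real_derivative flat (flat_step p) t) (at t)"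
      using 2 by (auto simp: flat_def)
    then show ?thesis
      by (rule DERIV_cong_ev[THEN iffD1, rotated -1])
        (use eventually_nhds_in_open[of "{..<0}" t] 2 in
          \<open>auto simp: flat_def elim!: eventually_mono\<close>)
  next
    case 3
    \<comment> \<open>The difference quotient at 0 is \<open>p(1/h) exp(-1/h) / h\<close>; with \<open>s = 1/h\<close> it becomes \<open>s p(s) exp(-s)\<close>.\<close>
    have "((\<lambda>h. poly ([:0,1:] * p) (inverse h) * exp (- inverse h)) \<longlongrightarrow> 0) (at_right 0)"
      by (rule filterlim_compose[OF poly_exp_tendsto_0 filterlim_inverse_at_top_right])
    then have R: "((\<lambda>h. flat p h / h) \<longlongrightarrow> 0) (at_right 0)"
      by (rule Lim_transform_eventually)
         (auto simp: flat_def eventually_at_right_field field_simps intro!: exI[of _ 1])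
    have L: "((\<lambda>h. flat p h / h) \<longlongrightarrow> 0) (at_left 0)"
      by (rule Lim_transform_eventually[OF tendsto_const])
         (auto simp: flat_def eventually_at_left_field intro!: exI[of _ "-1"])
    from L R have "((\<lambda>h. flat p h / h) \<longlongrightarrow> 0) (at 0)"
      by (simp add: filterlim_split_at_real)
    then show ?thesis using 3 by (simp add: has_field_derivative_iff flat_def)
  qed
qed

lemma diff_upto_flat:
  assumes "open W" "diff_upto k W q"
  shows "diff_upto k W (\<lambda>u. flat 1 (q u))"
  using diff_upto_compose_real[OF assms(1), of "\<lambda>n. flat ((flat_step ^^ n) 1)" k q 0] assms(2)
  by (simp add: flat_has_derivative)

lemma flat_one: "0 \<le> flat 1 t" "flat 1 t \<le> 1" "flat 1 t > 0 \<longleftrightarrow> t > 0"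
  by (auto simp: flat_def)

section \<open>Test functions on the manifold\<close>

lemma diff_upto_union:
  "diff_upto k W1 f \<Longrightarrow> diff_upto k W2 f \<Longrightarrow> diff_upto k (W1 \<union> W2) f"
  by (induction k arbitrary: f) auto

lemma diff_upto_sum:
  assumes "open W" "\<And>i. i \<in> S \<Longrightarrow> diff_upto k W (f i)"
  shows "diff_upto k W (\<lambda>u. \<Sum>i\<in>S. f i u)"
  using assms(2)
  by (induction S rule: infinite_finite_induct)
     (auto intro: diff_upto_const[OF assms(1)] diff_upto_add[OF assms(1)])

lemma diff_upto_const_minus:
  assumes "open W" "diff_upto k W f"
  shows "diff_upto k W (\<lambda>u. c - f u)"
  using diff_upto_add[OF assms(1) diff_upto_const[OF assms(1), of k c]
      diff_upto_mult[OF assms(1) diff_upto_const[OF assms(1), of k "-1"] assms(2)]]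
  by simp

lemma smooth_atlas_chart:
  assumes "smooth_atlas A" "c \<in> A"
  shows "open (fst c)" "open (snd c ` fst c)"
    "homeomorphism (fst c) (snd c ` fst c) (snd c) (chart_inv c)"
    "p \<in> fst c \<Longrightarrow> chart_inv c (snd c p) = p"
    "open U \<Longrightarrow> open (snd c ` (fst c \<inter> U))"
proof -
  show 1: "open (fst c)" "open (snd c ` fst c)"
    "homeomorphism (fst c) (snd c ` fst c) (snd c) (chart_inv c)"
    using assms by (auto simp: smooth_atlas_def)
  show "p \<in> fst c \<Longrightarrow> chart_inv c (snd c p) = p"
    using 1(3) by (simp add: homeomorphism_def)
  show "open (snd c ` (fst c \<inter> U))" if "open U"
  proof -
    have "openin (top_of_set (fst c)) (fst c \<inter> U)"
      using that by (simp add: openin_open_Int)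
    from homeomorphism_imp_open_map[OF 1(3) this] show ?thesis
      using 1(2) by (simp add: openin_open_eq)
  qed
qed

lemma smooth_atlas_cover:
  assumes "smooth_atlas A" obtains c where "c \<in> A" "p \<in> fst c"
  using assms UNIV_I[of p] unfolding smooth_atlas_def by blast

definition smooth_map :: "('x::topological_space, 'd::finite) chart set \<Rightarrow> ('x \<Rightarrow> real) \<Rightarrow> bool" where
  "smooth_map A f \<longleftrightarrow> (\<forall>c\<in>A. smooth_fun_on (snd c ` fst c) (f \<circ> chart_inv c))"

lemma smooth_map_iff:
  assumes "smooth_atlas A"
  shows "smooth_map A f \<longleftrightarrow> (\<forall>c\<in>A. \<forall>k. diff_upto k (snd c ` fst c) (\<lambda>u. f (chart_inv c u)))"
  unfolding smooth_map_def
  by (intro ball_cong refl)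
     (simp add: smooth_fun_on_iff_diff_upto[OF smooth_atlas_chart(2)[OF assms]] comp_def)

lemma smooth_map_const: "smooth_atlas A \<Longrightarrow> smooth_map A (\<lambda>_. a)"
  by (simp add: smooth_map_iff diff_upto_const smooth_atlas_chart(2))

lemma smooth_map_mult:
  "smooth_atlas A \<Longrightarrow> smooth_map A f \<Longrightarrow> smooth_map A g \<Longrightarrow> smooth_map A (\<lambda>x. f x * g x)"
  by (simp add: smooth_map_iff diff_upto_mult smooth_atlas_chart(2))

lemma smooth_map_const_minus:
  "smooth_atlas A \<Longrightarrow> smooth_map A f \<Longrightarrow> smooth_map A (\<lambda>x. a - f x)"
  by (simp add: smooth_map_iff diff_upto_const_minus smooth_atlas_chart(2))

lemma smooth_map_prod:
  assumes "smooth_atlas A" "\<And>i. i \<in> S \<Longrightarrow> smooth_map A (f i)"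
  shows "smooth_map A (\<lambda>x. \<Prod>i\<in>S. f i x)"
  using assms(2)
  by (induction S rule: infinite_finite_induct)
     (auto intro: smooth_map_const[OF assms(1)] smooth_map_mult[OF assms(1)])

lemma smooth_map_continuous:
  assumes A: "smooth_atlas A" and f: "smooth_map A f"
  shows "continuous_on UNIV f"
proof -
  have "continuous_on (fst c) f" if c: "c \<in> A" for c
  proof -
    have "continuous_on (snd c ` fst c) (f \<circ> chart_inv c)"
      using f c unfolding smooth_map_def
      by (intro continuous_at_imp_continuous_on ballI differentiable_imp_continuous_within)
         (rule smooth_fun_on_deriv(1), auto)
    then have "continuous_on (fst c) ((f \<circ> chart_inv c) \<circ> snd c)"
      by (rule continuous_on_compose[OF homeomorphism_cont1[OF smooth_atlas_chart(3)[OF A c]]])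
    then show ?thesis
      by (rule continuous_on_cong[THEN iffD1, rotated 2])
         (auto simp: smooth_atlas_chart(4)[OF A c])
  qed
  then have "continuous_on (\<Union>c\<in>A. fst c) f"
    by (intro continuous_on_open_UN) (auto simp: smooth_atlas_chart(1)[OF A])
  then show ?thesis using A by (simp add: smooth_atlas_def)
qed

text \<open>
  In a chart around \<open>p\<close>, the flat function of \<open>r\<^sup>2 - |u - u\<^sub>0|\<^sup>2\<close> is positive exactly on a ball, whose
  closure lies in the image of \<open>U\<close>. Extended by \<open>0\<close> it is smooth in any other chart: on the
  overlap it is a composition of smooth functions, and it vanishes off the closed ball, which is compact
  and hence closed in \<open>X\<close> by the Hausdorff property. As the closed ball lies in the first chart, the overlap
  and the complement of the ball are open and cover the second chart.
\<close>

lemma bump_exists: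
  assumes A: "smooth_atlas A" and U: "open U" and p: "p \<in> U"
  shows "\<exists>b. smooth_map A b \<and> (\<forall>q. 0 \<le> b q \<and> b q \<le> 1) \<and> open {q. b q > 0} \<and>
    p \<in> {q. b q > 0} \<and> {q. b q > 0} \<subseteq> U"
proof -
  obtain c where c: "c \<in> A" "p \<in> fst c" using smooth_atlas_cover[OF A] .
  note ch = smooth_atlas_chart[OF A c(1)]
  define u0 where "u0 = snd c p"
  have "open (snd c ` (fst c \<inter> U))" by (rule ch(5)[OF U])
  moreover have "u0 \<in> snd c ` (fst c \<inter> U)" using c p by (auto simp: u0_def)
  ultimately obtain r where r: "r > 0" "cball u0 r \<subseteq> snd c ` (fst c \<inter> U)"
    by (meson open_contains_cball)
  define Q where "Q u = r\<^sup>2 - (\<Sum>j\<in>Basis. (u \<bullet> j - u0 \<bullet> j) * (u \<bullet> j - u0 \<bullet> j))" for u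
  have Q: "Q u = r\<^sup>2 - (dist u0 u)\<^sup>2" for u
    unfolding Q_def dist_norm power2_norm_eq_inner
    by (subst euclidean_inner) (simp add: inner_diff_left algebra_simps)
  have Q_pos: "Q u > 0 \<longleftrightarrow> u \<in> ball u0 r" for u
    using r(1) by (simp add: Q) (smt (verit) pos2 power_mono_iff power_strict_mono zero_le_dist)
  define b where "b q = (if q \<in> fst c then flat 1 (Q (snd c q)) else 0)" for q
  have pos: "b q > 0 \<longleftrightarrow> q \<in> fst c \<and> snd c q \<in> ball u0 r" for q
    by (simp add: b_def flat_one(3) Q_pos del: mem_ball)
  have sub: "{q. b q > 0} \<subseteq> U"
  proof
    fix q assume "q \<in> {q. b q > 0}"
    then have q: "q \<in> fst c" "snd c q \<in> cball u0 r" by (auto simp: pos)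
    then obtain q' where q': "q' \<in> fst c \<inter> U" "snd c q = snd c q'" using r(2) by auto
    then have "q = q'" using ch(4)[OF q(1)] ch(4)[of q'] by (metis IntD1)
    then show "q \<in> U" using q' by simp
  qed
  have "{q. b q > 0} = snd c -` ball u0 r \<inter> fst c" by (auto simp: pos)
  moreover have "continuous_on (fst c) (snd c)" using ch(3) by (simp add: homeomorphism_def)
  ultimately have "open {q. b q > 0}"
    using ch(1) by (metis continuous_on_open_vimage open_ball)
  moreover have "p \<in> {q. b q > 0}" using c(2) r(1) by (simp add: pos u0_def)
  moreover have "smooth_map A b"
    unfolding smooth_map_iff[OF A]
  proof (intro ballI allI)
    fix c' k assume c': "c' \<in> A"
    note ch' = smooth_atlas_chart[OF A c']
    define C where "C = chart_inv c ` cball u0 r"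
    have "cball u0 r \<subseteq> snd c ` fst c" using r(2) by auto
    then have "compact C"
      unfolding C_def using ch(3)
      by (auto simp: homeomorphism_def intro!: compact_continuous_image elim: continuous_on_subset)
    then have "closed C" by (rule compact_imp_closed)
    have C_sub: "C \<subseteq> fst c"
      using \<open>cball u0 r \<subseteq> snd c ` fst c\<close> ch(4) by (auto simp: C_def)
    have b_C: "b q = 0" if "q \<notin> C" for q
    proof (rule ccontr)
      assume "b q \<noteq> 0"
      then have "b q > 0" by (auto simp: b_def less_le flat_one(1))
      then have q: "q \<in> fst c" "snd c q \<in> cball u0 r"
        by (auto simp: pos)
      then have "q \<in> C" unfolding C_def using ch(4)[OF q(1)] by (metis image_eqI)
      then show False using that by simp
    qed
    define W1 where "W1 = snd c' ` (fst c' \<inter> fst c)"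
    define W2 where "W2 = snd c' ` (fst c' \<inter> - C)"
    have o1: "open W1" unfolding W1_def by (rule ch'(5)[OF ch(1)])
    have o2: "open W2" unfolding W2_def by (rule ch'(5)) (use \<open>closed C\<close> in auto)
    have un: "snd c' ` fst c' = W1 \<union> W2" using C_sub by (auto simp: W1_def W2_def)
    have "smooth_fun_on W1 (transition c' c)"
      using A c(1) c' by (auto simp: smooth_atlas_def W1_def)
    then have h: "diff_upto k W1 (\<lambda>u. transition c' c u \<bullet> j)" for j
      by (rule diff_upto_component[OF o1])
    have h': "diff_upto k W1 (\<lambda>u. transition c' c u \<bullet> j - u0 \<bullet> j)" for j
      using diff_upto_add[OF o1 h[of j] diff_upto_const[OF o1, of k "- (u0 \<bullet> j)"]] by simp
    have "diff_upto k W1 (\<lambda>u. Q (transition c' c u))"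
      unfolding Q_def
      by (intro diff_upto_const_minus diff_upto_sum diff_upto_mult o1 h')
    then have "diff_upto k W1 (\<lambda>u. flat 1 (Q (transition c' c u)))"
      by (rule diff_upto_flat[OF o1])
    then have "diff_upto k W1 (\<lambda>u. b (chart_inv c' u))"
      by (rule diff_upto_cong[OF o1, rotated])
         (auto simp: W1_def b_def ch'(4) transition_def)
    moreover have "diff_upto k W2 (\<lambda>u. b (chart_inv c' u))"
      by (rule diff_upto_cong[OF o2 _ diff_upto_const[OF o2, of _ 0]])
         (auto simp: W2_def ch'(4) b_C)
    ultimately show "diff_upto k (snd c' ` fst c') (\<lambda>u. b (chart_inv c' u))"
      unfolding un by (rule diff_upto_union)
  qed
  moreover have "0 \<le> b q \<and> b q \<le> 1" for q by (simp add: b_def flat_one)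
  ultimately show ?thesis using sub by blast
qed

lemma test_funs_smooth: "f \<in> test_funs A \<Longrightarrow> smooth_map A f"
  by (simp add: test_funs_def smooth_map_def)

lemma test_funsI:
  assumes "smooth_map A f" "{x. f x \<noteq> 0} \<subseteq> S" "compact (closure S)"
  shows "f \<in> test_funs A"
proof -
  have "closure {x. f x \<noteq> 0} \<subseteq> closure S" using assms(2) by (rule closure_mono)
  then have "compact (closure {x. f x \<noteq> 0})"
    using assms(3) closed_closure[of "{x. f x \<noteq> 0}"] by (metis compact_Int_closed inf.absorb2)
  then show ?thesis using assms(1) by (simp add: test_funs_def smooth_map_def)
qed

lemma test_funs_mult:
  assumes "smooth_atlas A" "f \<in> test_funs A" "g \<in> test_funs A"
  shows "(\<lambda>x. f x * g x) \<in> test_funs A"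
proof (rule test_funsI[where S = "{x. f x \<noteq> 0}"])
  show "smooth_map A (\<lambda>x. f x * g x)"
    by (rule smooth_map_mult[OF assms(1) test_funs_smooth[OF assms(2)] test_funs_smooth[OF assms(3)]])
  show "compact (closure {x. f x \<noteq> 0})" using assms(2) by (simp add: test_funs_def)
qed auto

text \<open>
  By second countability, the sets of positivity of countably many bumps \<open>b\<^sub>j\<close> cover \<open>U\<close>. The functions
  \<open>1 - (\<Prod>j\<le>k. 1 - b\<^sub>j)\<^sup>k\<close> are smooth, vanish outside \<open>U\<close>, and converge to \<open>1\<close> at each point of \<open>U\<close>, because
  there the product is eventually below a fixed number less than \<open>1\<close> and its powers tend to \<open>0\<close>.
\<close>

lemma test_funs_approx_indicator:
  assumes A: "smooth_atlas A" and U: "U \<in> relatively_compact_open"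
  obtains \<xi> :: "nat \<Rightarrow> 'x::{t2_space, second_countable_topology} \<Rightarrow> real"
  where "\<And>k. \<xi> k \<in> test_funs (A :: ('x, 'd::finite) chart set)"
    "\<And>k x. 0 \<le> \<xi> k x" "\<And>k x. \<xi> k x \<le> indicator U x"
    "\<And>x. (\<lambda>k. \<xi> k x) \<longlonglongrightarrow> indicator U x"
proof -
  define BB where "BB = {b. smooth_map A b \<and> (\<forall>q. 0 \<le> b q \<and> b q \<le> 1) \<and> open {q. b q > 0} \<and>
    {q. b q > 0} \<subseteq> U}"
  define F where "F = (\<lambda>b. {q. b q > 0}) ` BB"
  have "open U" using U by (simp add: relatively_compact_open_def)
  have FU: "\<Union>F = U"
    using bump_exists[OF A \<open>open U\<close>] unfolding F_def BB_def by blast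
  have F_open: "open S" if "S \<in> F" for S
    using that unfolding F_def BB_def by blast
  from F_open obtain F' where F': "F' \<subseteq> F" "countable F'" "\<Union>F' = \<Union>F"
    by (rule Lindelof[of F])
  have "\<exists>B0. countable B0 \<and> B0 \<subseteq> BB \<and> F' = (\<lambda>b. {q. b q > 0}) ` B0"
    using F'(1,2) countable_subset_image[of F' "\<lambda>b. {q. b q > 0}" BB] unfolding F_def by blast
  then obtain B0 where B0: "B0 \<subseteq> BB" "countable B0" "F' = (\<lambda>b. {q. b q > 0}) ` B0"
    by blast
  have cov: "(\<Union>b\<in>B0. {q. b q > 0}) = U" using F'(3) FU B0(3) by simp
  \<comment> \<open>The zero function is added so that the enumeration is meaningful even if \<open>U\<close> is empty.\<close>
  define b where "b = from_nat_into (insert (\<lambda>_. 0) B0)"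
  have b_BB: "b j \<in> BB" for j
    using from_nat_into[of "insert (\<lambda>_. 0) B0" j] B0(1) smooth_map_const[OF A, of 0]
    by (auto simp: b_def BB_def)
  have range_b: "range b = insert (\<lambda>_. 0) B0"
    unfolding b_def using B0(2) by (intro range_from_nat_into) auto
  have b_bd: "0 \<le> b j q" "b j q \<le> 1" "q \<notin> U \<Longrightarrow> b j q = 0" for j q
    using b_BB[of j] by (auto simp: BB_def order.order_iff_strict)
  define R where "R k q = (\<Prod>j\<le>k. 1 - b j q)" for k q
  have R: "0 \<le> R k q" "R k q \<le> 1" for k q
    using b_bd by (auto simp: R_def intro!: prod_nonneg prod_le_1)
  define \<xi> where "\<xi> k q = 1 - (\<Prod>i<k. R k q)" for k q
  have \<xi>: "\<xi> k q = 1 - R k q ^ k" for k q by (simp add: \<xi>_def)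
  have out: "\<xi> k q = 0" if "q \<notin> U" for k q
    using that by (simp add: \<xi> R_def b_bd(3))
  show thesis
  proof (rule that)
    show "\<xi> k \<in> test_funs A" for k
    proof (rule test_funsI)
      show "smooth_map A (\<xi> k)"
        unfolding \<xi>_def R_def using b_BB
        by (intro smooth_map_const_minus smooth_map_prod A) (auto simp: BB_def)
      show "{x. \<xi> k x \<noteq> 0} \<subseteq> U" using out by auto
      show "compact (closure U)" using U by (simp add: relatively_compact_open_def)
    qed
    show "0 \<le> \<xi> k x" for k x using R by (simp add: \<xi> power_le_one)
    show "\<xi> k x \<le> indicator U x" for k x
      using R[where q = x and k = k] out[of x k] by (cases "x \<in> U") (auto simp: \<xi>)
    show "(\<lambda>k. \<xi> k x) \<longlonglongrightarrow> indicator U x" for x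
    proof (cases "x \<in> U")
      case True
      then obtain b' where b': "b' \<in> B0" "b' x > 0" using cov by auto
      then obtain j where j: "b j = b'" using range_b by (metis insertI2 rangeE)
      have "R k x \<le> 1 - b j x" if "k \<ge> j" for k
      proof -
        have "R k x = (1 - b j x) * (\<Prod>i\<in>{..k}-{j}. 1 - b i x)"
          unfolding R_def using that by (subst prod.remove[of _ j]) auto
        also have "\<dots> \<le> (1 - b j x) * 1"
          using b_bd by (intro mult_left_mono prod_le_1) auto
        finally show ?thesis by simp
      qed
      then have le: "R k x ^ k \<le> (1 - b j x) ^ k" if "k \<ge> j" for k
        using that R by (intro power_mono) auto
      have lim: "(\<lambda>k. (1 - b j x) ^ k) \<longlonglongrightarrow> 0"
        using b' j b_bd(2)[of j x] by (intro LIMSEQ_power_zero) auto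
      have "(\<lambda>k. R k x ^ k) \<longlonglongrightarrow> 0"
      proof (rule tendsto_sandwich[OF _ _ tendsto_const lim])
        show "\<forall>\<^sub>F k in sequentially. R k x ^ k \<le> (1 - b j x) ^ k"
          by (rule eventually_sequentiallyI[of j]) (rule le)
      qed (simp add: R(1))
      then have "(\<lambda>k. 1 - R k x ^ k) \<longlonglongrightarrow> 1 - 0" by (intro tendsto_intros)
      then show ?thesis using True by (simp add: \<xi>)
    next
      case False
      then show ?thesis by (simp add: out)
    qed
  qed
qed

section \<open>Product kernels\<close>

definition prod_kernel :: "nat \<Rightarrow> (nat \<Rightarrow> 'y \<Rightarrow> real) \<Rightarrow> (nat \<Rightarrow> 'y) \<Rightarrow> complex" where
  "prod_kernel n g x = (\<Prod>i\<in>{1..n}. complex_of_real (g i (x i)))"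

lemma prod_kernel_line_derivative:
  fixes u :: "nat \<Rightarrow> 'e::euclidean_space"
  assumes i: "i \<in> {1..n}" and d: "g i differentiable (at (u i))"
  shows "((\<lambda>t. prod_kernel n g (u(i := u i + t *\<^sub>R v))) has_vector_derivative
     prod_kernel n (g(i := \<lambda>x. frechet_derivative (g i) (at x) v)) u) (at 0)"
proof -
  define R where "R = (\<Prod>j\<in>{1..n} - {i}. complex_of_real (g j (u j)))"
  have "((\<lambda>t. u i + t *\<^sub>R v) has_vector_derivative v) (at (0::real))"
    by (auto intro!: derivative_eq_intros)
  moreover have "(g i has_derivative frechet_derivative (g i) (at (u i)))
      (at (u i + 0 *\<^sub>R v) within range (\<lambda>t. u i + t *\<^sub>R v))"
    using d by (simp add: frechet_derivative_works has_derivative_at_withinI)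
  ultimately have "((g i \<circ> (\<lambda>t. u i + t *\<^sub>R v)) has_vector_derivative
      frechet_derivative (g i) (at (u i)) v) (at 0)"
    by (rule vector_derivative_diff_chain_within)
  then have "((\<lambda>t. g i (u i + t *\<^sub>R v)) has_real_derivative frechet_derivative (g i) (at (u i)) v) (at 0)"
    by (simp add: has_real_derivative_iff_has_vector_derivative comp_def)
  then have "((\<lambda>t. complex_of_real (g i (u i + t *\<^sub>R v)) * R) has_vector_derivative
      complex_of_real (frechet_derivative (g i) (at (u i)) v) * R) (at 0)"
    by (intro has_vector_derivative_mult_left has_vector_derivative_of_real)
  moreover have "complex_of_real (g i (u i + t *\<^sub>R v)) * R = prod_kernel n g (u(i := u i + t *\<^sub>R v))" for t
    unfolding prod_kernel_def R_def by (subst prod.remove[OF _ i]) simp_all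
  moreover have "complex_of_real (frechet_derivative (g i) (at (u i)) v) * R
      = prod_kernel n (g(i := \<lambda>x. frechet_derivative (g i) (at x) v)) u"
    unfolding prod_kernel_def R_def by (subst prod.remove[OF _ i]) simp_all
  ultimately show ?thesis by simp
qed

text \<open>
  A mixed partial derivative of a product \<open>\<Prod>i. g\<^sub>i(u\<^sub>i)\<close> is again such a product. In it the factor \<open>g\<^sub>i\<close> has been
  differentiated along those directions that were applied to the variable \<open>i\<close>, in the same order.
\<close>

definition pick_derivs :: "(nat \<times> 'v) list \<Rightarrow> nat \<Rightarrow> 'v list" where
  "pick_derivs ivs i = map snd (filter (\<lambda>p. fst p = i) ivs)"

lemma iter_deriv_pick_Cons:
  "(\<lambda>j. iter_deriv (pick_derivs ((i, v) # ivs) j) (g j)) =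
   (\<lambda>j. iter_deriv (pick_derivs ivs j) (g j))
     (i := \<lambda>x. frechet_derivative (iter_deriv (pick_derivs ivs i) (g i)) (at x) v)"
  by (auto simp: pick_derivs_def fun_eq_iff)

lemma pick_derivs_in_lists:
  "ivs \<in> lists ({1..n} \<times> B) \<Longrightarrow> pick_derivs ivs i \<in> lists B"
  by (induction ivs) (auto simp: pick_derivs_def)

context
  fixes n :: nat and V :: "nat \<Rightarrow> (real ^ 'd::finite) set"
    and F :: "(nat \<Rightarrow> real ^ 'd) \<Rightarrow> complex"
    and S :: "'s set" and a :: "'s \<Rightarrow> complex" and g :: "'s \<Rightarrow> nat \<Rightarrow> real ^ 'd \<Rightarrow> real"
  assumes V: "\<And>i. i \<in> {1..n} \<Longrightarrow> open (V i)"
    and F: "\<And>u. u \<in> PiE {1..n} V \<Longrightarrow> F u = (\<Sum>s\<in>S. a s * prod_kernel n (g s) u)"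
    and smooth: "\<And>s i. s \<in> S \<Longrightarrow> i \<in> {1..n} \<Longrightarrow> smooth_fun_on (V i) (g s i)"
begin

lemma sum_prod_line_derivative:
  fixes H :: "(nat \<Rightarrow> real ^ 'd) \<Rightarrow> complex"
  assumes H: "\<And>u. u \<in> PiE {1..n} V \<Longrightarrow>
      H u = (\<Sum>s\<in>S. a s * prod_kernel n (\<lambda>j. iter_deriv (pick_derivs ivs j) (g s j)) u)"
    and ivs: "ivs \<in> lists ({1..n} \<times> Basis)"
    and u: "u \<in> PiE {1..n} V" and i: "i \<in> {1..n}"
  shows "((\<lambda>t. H (u(i := u i + t *\<^sub>R v))) has_vector_derivative
      (\<Sum>s\<in>S. a s * prod_kernel n (\<lambda>j. iter_deriv (pick_derivs ((i, v) # ivs) j) (g s j)) u)) (at 0)"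
proof -
  have lim: "isCont (\<lambda>t. u i + t *\<^sub>R v) t" for t :: real by (intro continuous_intros)
  have op: "open ((\<lambda>t. u i + t *\<^sub>R v) -` V i)"
    using V[OF i] lim by (intro open_vimage) (auto intro: continuous_at_imp_continuous_on)
  have 0: "0 \<in> (\<lambda>t. u i + t *\<^sub>R v) -` V i" using u i by auto
  have der: "((\<lambda>t. \<Sum>s\<in>S. a s * prod_kernel n (\<lambda>j. iter_deriv (pick_derivs ivs j) (g s j)) (u(i := u i + t *\<^sub>R v)))
      has_vector_derivative
      (\<Sum>s\<in>S. a s * prod_kernel n (\<lambda>j. iter_deriv (pick_derivs ((i, v) # ivs) j) (g s j)) u)) (at 0)"
    unfolding iter_deriv_pick_Cons
  proof (intro has_vector_derivative_sum has_vector_derivative_mult_right prod_kernel_line_derivative[OF i])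
    fix s assume "s \<in> S"
    then show "iter_deriv (pick_derivs ivs i) (g s i) differentiable at (u i)"
      using smooth[OF _ i] pick_derivs_in_lists[OF ivs] u i unfolding smooth_fun_on_def by blast
  qed
  show ?thesis
  proof (rule has_vector_derivative_transform_within_open[OF der op 0])
    fix t assume "t \<in> (\<lambda>t. u i + t *\<^sub>R v) -` V i"
    then have "u(i := u i + t *\<^sub>R v) \<in> PiE {1..n} V" using u i by (auto simp: PiE_iff extensional_def)
    from H[OF this] show "(\<Sum>s\<in>S. a s * prod_kernel n (\<lambda>j. iter_deriv (pick_derivs ivs j) (g s j)) (u(i := u i + t *\<^sub>R v)))
      = H (u(i := u i + t *\<^sub>R v))" by simp
  qed
qed

lemma iter_partial_sum_prod:
  assumes "ivs \<in> lists ({1..n} \<times> Basis)" "u \<in> PiE {1..n} V"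
  shows "iter_partial ivs F u =
    (\<Sum>s\<in>S. a s * prod_kernel n (\<lambda>j. iter_deriv (pick_derivs ivs j) (g s j)) u)"
  using assms
proof (induction ivs arbitrary: u rule: list.induct)
  case Nil
  then show ?case by (simp add: F pick_derivs_def)
next
  case (Cons iv ivs)
  obtain i v where iv: "iv = (i, v)" by (cases iv)
  have i: "i \<in> {1..n}" and ivs: "ivs \<in> lists ({1..n} \<times> Basis)" using Cons.prems iv by auto
  show ?case
    unfolding iv iter_partial.simps
    by (rule vector_derivative_at) (rule sum_prod_line_derivative[OF Cons.IH[OF ivs] ivs Cons.prems(2) i])
qed

lemma multi_smooth_on_sum_prod: "multi_smooth_on n (PiE {1..n} V) F"
  unfolding multi_smooth_on_def
proof (intro ballI conjI)
  fix ivs :: "(nat \<times> (real ^ 'd)) list" assume ivs: "ivs \<in> lists ({1..n} \<times> Basis)"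
  note eq = iter_partial_sum_prod[OF ivs]
  have cont: "continuous_on (PiE {1..n} V) (\<lambda>u. iter_deriv (pick_derivs ivs j) (g s j) (u j))"
    if "s \<in> S" "j \<in> {1..n}" for s j
  proof (rule continuous_on_compose2[where g = "iter_deriv (pick_derivs ivs j) (g s j)"])
    show "continuous_on (V j) (iter_deriv (pick_derivs ivs j) (g s j))"
      using smooth[OF that] pick_derivs_in_lists[OF ivs] unfolding smooth_fun_on_def
      by (intro continuous_at_imp_continuous_on ballI differentiable_imp_continuous_within) blast
    show "continuous_on (PiE {1..n} V) (\<lambda>u. u j)"
      by (rule continuous_on_subset[OF continuous_on_product_coordinates]) simp
  qed (use that in auto)
  show "continuous_on (PiE {1..n} V) (iter_partial ivs F)"
  proof (rule continuous_on_cong[THEN iffD2, OF refl eq])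
    show "continuous_on (PiE {1..n} V)
        (\<lambda>u. \<Sum>s\<in>S. a s * prod_kernel n (\<lambda>j. iter_deriv (pick_derivs ivs j) (g s j)) u)"
      unfolding prod_kernel_def by (intro continuous_intros cont)
  qed
  fix u i and v :: "real ^ 'd" assume "u \<in> PiE {1..n} V" "i \<in> {1..n}" "v \<in> Basis"
  from sum_prod_line_derivative[OF eq ivs this(1,2)]
  show "(\<lambda>t. iter_partial ivs F (u(i := u i + t *\<^sub>R v))) differentiable at 0"
    unfolding has_vector_derivative_def by (rule differentiableI)
qed

end

text \<open>
  Only sums of products of test functions are ever needed as test kernels. For them, all conditions
  on partial derivatives reduce to the smoothness of functions of one variable.
\<close>

lemma test_kernelsI:
  assumes A: "smooth_atlas (A :: ('x::{t2_space, second_countable_topology}, 'd::finite) chart set)"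
    and sym: "sym_kernel n f" and "finite S"
    and f: "\<And>x. f x = (\<Sum>s\<in>S. a s * prod_kernel n (g s) x)"
    and g: "\<And>s i. s \<in> S \<Longrightarrow> i \<in> {1..n} \<Longrightarrow> g s i \<in> test_funs A"
  shows "f \<in> test_kernels A n"
  unfolding test_kernels_def mem_Collect_eq
proof (intro conjI allI impI sym)
  define K where "K = (\<Union>s\<in>S. \<Union>i\<in>{1..n}. closure {x. g s i x \<noteq> 0})"
  have "compact K"
    unfolding K_def using \<open>finite S\<close> g by (intro compact_UN) (auto simp: test_funs_def)
  moreover have "x \<in> PiE {1..n} (\<lambda>_. K)" if x: "x \<in> power_pts n" "f x \<noteq> 0" for x
  proof -
    obtain s where s: "s \<in> S" "prod_kernel n (g s) x \<noteq> 0"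
      using x(2) unfolding f by (metis (no_types, lifting) mult_zero_right sum.not_neutral_contains_not_neutral)
    then have "x i \<in> closure {x. g s i x \<noteq> 0}" if "i \<in> {1..n}" for i
      using that closure_subset[of "{x. g s i x \<noteq> 0}"] by (auto simp: prod_kernel_def)
    then show ?thesis using x(1) s(1) unfolding K_def PiE_iff by blast
  qed
  ultimately show "\<exists>K. compact K \<and> (\<forall>x\<in>power_pts n. f x \<noteq> 0 \<longrightarrow> x \<in> PiE {1..n} (\<lambda>_. K))"
    by blast
  fix c assume c: "\<forall>i\<in>{1..n}. c i \<in> A"
  show "multi_smooth_on n (PiE {1..n} (\<lambda>i. snd (c i) ` fst (c i)))
      (\<lambda>u. f (\<lambda>i\<in>{1..n}. chart_inv (c i) (u i)))"
  proof (rule multi_smooth_on_sum_prod[where S = S and a = a and g = "\<lambda>s i. g s i \<circ> chart_inv (c i)"])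
    show "open (snd (c i) ` fst (c i))" if "i \<in> {1..n}" for i
      using c that smooth_atlas_chart(2)[OF A] by blast
    show "smooth_fun_on (snd (c i) ` fst (c i)) (g s i \<circ> chart_inv (c i))"
      if "s \<in> S" "i \<in> {1..n}" for s i
      using g[OF that] c that by (auto simp: test_funs_def)
    show "f (\<lambda>i\<in>{1..n}. chart_inv (c i) (u i)) =
      (\<Sum>s\<in>S. a s * prod_kernel n (\<lambda>i. g s i \<circ> chart_inv (c i)) u)" for u
      unfolding f prod_kernel_def by (intro sum.cong refl arg_cong2[where f = "(*)"] prod.cong) auto
  qed
qed

section \<open>Symmetrization\<close>

lemma prod_kernel_permute:
  assumes "\<pi> permutes {1..n}"
  shows "prod_kernel n g (\<lambda>i\<in>{1..n}. x (\<pi> i)) = prod_kernel n (\<lambda>i. g (inv \<pi> i)) x"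
proof -
  have "(\<Prod>j\<in>{1..n}. complex_of_real (g (inv \<pi> j) (x j))) =
      (\<Prod>i\<in>{1..n}. complex_of_real (g (inv \<pi> (\<pi> i)) (x (\<pi> i))))"
    using prod.permute[OF assms, of "\<lambda>j. complex_of_real (g (inv \<pi> j) (x j))"] by (simp add: comp_def)
  then show ?thesis by (simp add: prod_kernel_def permutes_inverses(2)[OF assms])
qed

lemma sym_kernel_symmetrize: "sym_kernel n (symmetrize n f)"
  unfolding sym_kernel_def
proof (intro allI impI ballI)
  fix \<rho> :: "nat \<Rightarrow> nat" and x :: "nat \<Rightarrow> 'a"
  assume \<rho>: "\<rho> permutes {1..n}"
  have "(\<Sum>\<pi> | \<pi> permutes {1..n}. f (\<lambda>i\<in>{1..n}. x (\<pi> i))) =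
      (\<Sum>\<pi> | \<pi> permutes {1..n}. f (\<lambda>i\<in>{1..n}. x ((\<rho> \<circ> \<pi>) i)))"
    by (rule setum_permutations_compose_left[OF \<rho>])
  also have "\<dots> = (\<Sum>\<pi> | \<pi> permutes {1..n}. f (\<lambda>i\<in>{1..n}. (\<lambda>i\<in>{1..n}. x (\<rho> i)) (\<pi> i)))"
  proof (intro sum.cong refl arg_cong[where f = f] ext)
    fix \<pi> i assume "\<pi> \<in> {\<pi>. \<pi> permutes {1..n}}"
    then have "i \<in> {1..n} \<Longrightarrow> \<pi> i \<in> {1..n}" by (simp add: permutes_in_image del: atLeastAtMost_iff)
    then show "(\<lambda>i\<in>{1..n}. x ((\<rho> \<circ> \<pi>) i)) i = (\<lambda>i\<in>{1..n}. (\<lambda>i\<in>{1..n}. x (\<rho> i)) (\<pi> i)) i"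
      by (simp add: restrict_def)
  qed
  finally show "symmetrize n f (\<lambda>i\<in>{1..n}. x (\<rho> i)) = symmetrize n f x"
    by (simp add: symmetrize_def)
qed

lemma symmetrize_prod_kernel:
  "symmetrize n (prod_kernel n g) x =
    (\<Sum>\<pi> | \<pi> permutes {1..n}. (1 / of_nat (fact n)) * prod_kernel n (\<lambda>i. g (inv \<pi> i)) x)"
  unfolding symmetrize_def sum_divide_distrib
  by (intro sum.cong refl) (simp add: prod_kernel_permute del: One_nat_def)

text \<open>
  All \<open>n!\<close> permutations give the same product when the factors are equal.
\<close>

lemma symmetrize_power:
  "symmetrize n (prod_kernel n (\<lambda>_. h)) = prod_kernel n (\<lambda>_. h)"
  by (simp add: fun_eq_iff symmetrize_prod_kernel card_permutations[where n = n] del: One_nat_def)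

lemma zero_test_kernel:
  assumes "smooth_atlas (A :: ('x::{t2_space, second_countable_topology}, 'd::finite) chart set)"
  shows "(\<lambda>_. 0) \<in> test_kernels A n"
  by (rule test_kernelsI[OF assms, where S = "{}" and a = "\<lambda>_. 0" and g = "\<lambda>_ _ _. 0"])
     (auto simp: sym_kernel_def)

section \<open>The field operator on a power of a test function\<close>

lemma prod_kernel_Suc:
  "prod_kernel (Suc n) g x = complex_of_real (g 1 (x 1)) * prod_kernel n (\<lambda>i. g (Suc i)) (\<lambda>i. x (Suc i))"
  unfolding prod_kernel_def
  by (simp add: prod.atLeast_Suc_atMost prod.shift_bounds_cl_Suc_ivl del: prod.cl_ivl_Suc)

lemma prod_kernel_cong:
  "(\<And>i. i \<in> {1..n} \<Longrightarrow> g i (x i) = h i (y i)) \<Longrightarrow> prod_kernel n g x = prod_kernel n h y"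
  unfolding prod_kernel_def by (rule prod.cong) auto

text \<open>
  Multiplying by a function of the first variable changes the first factor only. In this form the
  neutral operator and the second annihilation operator produce symmetrized products.
\<close>

lemma prod_kernel_head:
  assumes "n > 0"
  shows "complex_of_real (h (x 1)) * prod_kernel n (\<lambda>_. \<xi>) x =
    prod_kernel n (\<lambda>i. if i = 1 then \<lambda>y. h y * \<xi> y else \<xi>) x"
proof -
  have 1: "1 \<in> {1..n}" using assms by simp
  show ?thesis
    unfolding prod_kernel_def prod.remove[OF finite_atLeastAtMost 1]
    by (simp add: mult.assoc)
qed

text \<open>
  The value of the field operator at \<open>\<xi>\<^sup>\<otimes>\<^sup>n\<close>, see \<open>field_op_power\<close>. Unlike the operator itself, the
  formula is also used for \<open>\<xi> = \<chi>\<close>, where it gives the limit of the images of smooth approximations.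
  The numbers of permutations that put a given point in the first place are not evaluated, since they
  disappear in that limit.
\<close>

definition field_image :: "'x measure \<Rightarrow> real \<Rightarrow> ('x \<Rightarrow> real) \<Rightarrow> nat \<Rightarrow> 'x fock_vec" where
  "field_image \<sigma> lam \<xi> n m x =
     (if m = Suc n then prod_kernel m (\<lambda>_. \<xi>) x else 0)
   + (if m = n then
        of_real (lam * real n) *
          symmetrize m (prod_kernel m (\<lambda>i. if i = 1 then \<lambda>y. \<xi> y * \<xi> y else \<xi>)) x
        + of_real (c_lam lam * integral\<^sup>L \<sigma> \<xi>) * prod_kernel m (\<lambda>_. \<xi>) x else 0)
   + (if Suc m = n then
        of_real (real n * (\<integral>y. \<xi> y * \<xi> y \<partial>\<sigma>)) * prod_kernel m (\<lambda>_. \<xi>) x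
        + of_real (real n * (real n - 1)) *
          symmetrize m (prod_kernel m (\<lambda>i. if i = 1 then \<lambda>y. (\<xi> y * \<xi> y) * \<xi> y else \<xi>)) x else 0)"

lemma creation_power: "creation \<xi> n (prod_kernel n (\<lambda>_. \<xi>)) = prod_kernel (Suc n) (\<lambda>_. \<xi>)"
proof -
  have "(\<lambda>x. of_real (\<xi> (x 1)) * prod_kernel n (\<lambda>_. \<xi>) (\<lambda>i\<in>{1..n}. x (Suc i))) = prod_kernel (Suc n) (\<lambda>_. \<xi>)"
    unfolding prod_kernel_Suc
    by (intro ext arg_cong2[where f = "(*)"] refl prod_kernel_cong) auto
  then show ?thesis by (simp add: creation_def symmetrize_power)
qed

lemma neutral_power:
  "neutral \<xi> n (prod_kernel n (\<lambda>_. \<xi>)) x = of_nat n *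
     symmetrize n (prod_kernel n (\<lambda>i. if i = 1 then \<lambda>y. \<xi> y * \<xi> y else \<xi>)) x"
proof (cases "n > 0")
  case True
  show ?thesis unfolding neutral_def prod_kernel_head[OF True] ..
qed (simp add: neutral_def)

lemma prod_kernel_prepend:
  "prod_kernel (Suc m) (\<lambda>_. \<xi>) (prepend m z x) = complex_of_real (\<xi> z) * prod_kernel m (\<lambda>_. \<xi>) x"
  unfolding prod_kernel_Suc
  by (intro arg_cong2[where f = "(*)"] prod_kernel_cong) (auto simp: prepend_def)

lemma annihilation1_power:
  "annihilation1 \<sigma> \<xi> (Suc m) (prod_kernel (Suc m) (\<lambda>_. \<xi>)) x =
     of_real (real (Suc m) * (\<integral>y. \<xi> y * \<xi> y \<partial>\<sigma>)) * prod_kernel m (\<lambda>_. \<xi>) x"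
proof -
  have "(\<integral>z. of_real (\<xi> z) * (complex_of_real (\<xi> z) * prod_kernel m (\<lambda>_. \<xi>) x) \<partial>\<sigma>) =
     (\<integral>z. complex_of_real (\<xi> z * \<xi> z) * prod_kernel m (\<lambda>_. \<xi>) x \<partial>\<sigma>)"
    by (simp add: mult.assoc)
  also have "\<dots> = of_real (\<integral>y. \<xi> y * \<xi> y \<partial>\<sigma>) * prod_kernel m (\<lambda>_. \<xi>) x"
    by (simp only: integral_mult_left_zero integral_complex_of_real)
  finally show ?thesis
    by (simp add: annihilation1_def prod_kernel_prepend)
qed

lemma annihilation2_power:
  "annihilation2 \<xi> (Suc m) (prod_kernel (Suc m) (\<lambda>_. \<xi>)) x = of_real (real (Suc m) * (real (Suc m) - 1)) *
     symmetrize m (prod_kernel m (\<lambda>i. if i = 1 then \<lambda>y. (\<xi> y * \<xi> y) * \<xi> y else \<xi>)) x"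
proof (cases "m > 0")
  case True
  have "of_real (\<xi> (x 1)) * (complex_of_real (\<xi> (x 1)) * prod_kernel m (\<lambda>_. \<xi>) x) =
    prod_kernel m (\<lambda>i. if i = 1 then \<lambda>y. (\<xi> y * \<xi> y) * \<xi> y else \<xi>) x" for x
    unfolding prod_kernel_head[OF True, symmetric] by simp
  then show ?thesis by (simp add: annihilation2_def prod_kernel_prepend algebra_simps del: One_nat_def)
qed (simp add: annihilation2_def)

lemma field_op_power:
  "field_op \<sigma> lam \<xi> (fock_embed n (prod_kernel n (\<lambda>_. \<xi>))) = field_image \<sigma> lam \<xi> n"
proof (intro ext)
  fix m :: nat and x :: "nat \<Rightarrow> 'a"
  have c: "(if m = 0 then 0 else creation \<xi> (m - 1) (fock_embed n (prod_kernel n (\<lambda>_. \<xi>)) (m - 1)) x) =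
     (if m = Suc n then prod_kernel m (\<lambda>_. \<xi>) x else 0)"
    by (cases m) (auto simp: fock_embed_def creation_power, simp add: creation_def symmetrize_def)
  have n: "neutral \<xi> m (fock_embed n (prod_kernel n (\<lambda>_. \<xi>)) m) x =
    (if m = n then of_nat n *
          symmetrize m (prod_kernel m (\<lambda>i. if i = 1 then \<lambda>y. \<xi> y * \<xi> y else \<xi>)) x else 0)"
    by (auto simp: fock_embed_def neutral_power simp del: One_nat_def, simp add: neutral_def symmetrize_def)
  have a1: "annihilation1 \<sigma> \<xi> (Suc m) (fock_embed n (prod_kernel n (\<lambda>_. \<xi>)) (Suc m)) x =
    (if Suc m = n then of_real (real n * (\<integral>y. \<xi> y * \<xi> y \<partial>\<sigma>)) * prod_kernel m (\<lambda>_. \<xi>) x else 0)"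
    by (auto simp: fock_embed_def annihilation1_power, simp add: annihilation1_def)
  have a2: "annihilation2 \<xi> (Suc m) (fock_embed n (prod_kernel n (\<lambda>_. \<xi>)) (Suc m)) x =
    (if Suc m = n then of_real (real n * (real n - 1)) *
          symmetrize m (prod_kernel m (\<lambda>i. if i = 1 then \<lambda>y. (\<xi> y * \<xi> y) * \<xi> y else \<xi>)) x else 0)"
  proof (cases "Suc m = n")
    case True
    then show ?thesis using annihilation2_power[of \<xi> m x] by (simp add: fock_embed_def del: One_nat_def of_nat_Suc)
  next
    case False
    then show ?thesis by (simp add: fock_embed_def annihilation2_def symmetrize_def)
  qed
  show "field_op \<sigma> lam \<xi> (fock_embed n (prod_kernel n (\<lambda>_. \<xi>))) m x = field_image \<sigma> lam \<xi> n m x"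
    unfolding field_op_def c n a1 a2 field_image_def
    by (simp add: fock_embed_def del: One_nat_def)
qed

lemma indicator_power_eq: "indicator_power n S = prod_kernel n (\<lambda>_. indicator S)"
  by (auto simp: indicator_power_def prod_kernel_def fun_eq_iff indicator_def intro!: prod.cong)

text \<open>
  Since \<open>\<chi>\<^sup>2 = \<chi>\<^sup>3 = \<chi>\<close>, every symmetrized product in the image is a power of \<open>\<chi>\<close>. For \<open>n = 0\<close> the
  last term has coefficient \<open>0\<close>, so that the truncated degree \<open>n - 1\<close> does no harm.
\<close>

lemma field_image_indicator:
  assumes "S \<in> sets \<sigma>" "emeasure \<sigma> S < \<infinity>"
  shows "field_image \<sigma> lam (indicator S) n m x =
     fock_embed (Suc n) (indicator_power (Suc n) S) m x
     + of_real (lam * real n + c_lam lam * measure \<sigma> S) * fock_embed n (indicator_power n S) m x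
     + of_real (real n * (real n - 1 + measure \<sigma> S)) * fock_embed (n - 1) (indicator_power (n - 1) S) m x"
proof -
  have sq: "(\<lambda>y. indicator S y * indicator S y :: real) = indicator S"
    by (auto simp: indicator_def)
  have cu: "(\<lambda>y. (indicator S y * indicator S y) * indicator S y :: real) = indicator S"
    by (auto simp: indicator_def)
  have i: "integral\<^sup>L \<sigma> (indicator S) = measure \<sigma> S"
    using assms by simp
  show ?thesis
    unfolding field_image_def sq cu if_cancel i symmetrize_power indicator_power_eq fock_embed_def
    by (cases n) (auto simp: algebra_simps)
qed

section \<open>Loops\<close>

lemma loop_points_loop_of: "loop_points (loop_of xs) = set xs"
  by (auto simp: loop_points_def loop_of_def)

definition loop_through :: "nat list set set \<Rightarrow> nat \<Rightarrow> nat list set" where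
  "loop_through \<alpha> i = (THE \<kappa>. \<kappa> \<in> \<alpha> \<and> i \<in> loop_points \<kappa>)"

context
  fixes n :: nat and \<alpha> :: "nat list set set"
  assumes \<alpha>: "\<alpha> \<in> loop_collections n"
begin

lemma loop_points_nonempty: "\<kappa> \<in> \<alpha> \<Longrightarrow> loop_points \<kappa> \<noteq> {}"
  using \<alpha> by (auto simp: loop_collections_def loop_points_loop_of dest!: subsetD)

lemma loop_points_subset: "\<kappa> \<in> \<alpha> \<Longrightarrow> loop_points \<kappa> \<subseteq> {1..n}"
  using \<alpha> by (auto simp: loop_collections_def)

lemma loop_points_unique:
  assumes "\<kappa> \<in> \<alpha>" "\<kappa>' \<in> \<alpha>" "i \<in> loop_points \<kappa>" "i \<in> loop_points \<kappa>'"
  shows "\<kappa> = \<kappa>'"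
proof (rule ccontr)
  assume "\<kappa> \<noteq> \<kappa>'"
  then have "loop_points \<kappa> \<inter> loop_points \<kappa>' = {}"
    using \<alpha> assms(1,2) by (auto simp: loop_collections_def disjoint_family_on_def)
  then show False using assms(3,4) by blast
qed

text \<open>
  Loops of a collection are determined by their underlying sets, as these are disjoint and
  nonempty.
\<close>

lemma finite_loop_collection: "finite \<alpha>"
proof (rule finite_imageD)
  show "finite (loop_points ` \<alpha>)"
    by (rule finite_subset[of _ "Pow {1..n}"]) (use loop_points_subset in auto)
  show "inj_on loop_points \<alpha>"
    by (rule inj_onI) (metis loop_points_nonempty loop_points_unique ex_in_conv)
qed

lemma loop_through_eq: "\<kappa> \<in> \<alpha> \<Longrightarrow> i \<in> loop_points \<kappa> \<Longrightarrow> loop_through \<alpha> i = \<kappa>"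
  unfolding loop_through_def by (rule the_equality) (metis loop_points_unique)+

lemma loop_through_in:
  assumes "i \<in> {1..n}" shows "loop_through \<alpha> i \<in> \<alpha>"
proof -
  have "i \<in> (\<Union>\<kappa>\<in>\<alpha>. loop_points \<kappa>)" using \<alpha> assms by (simp add: loop_collections_def)
  then obtain \<kappa> where "\<kappa> \<in> \<alpha>" "i \<in> loop_points \<kappa>" by blast
  then show ?thesis by (simp add: loop_through_eq)
qed

lemma loop_through_surj: "\<kappa> \<in> \<alpha> \<Longrightarrow> \<exists>i\<in>{1..n}. loop_through \<alpha> i = \<kappa>"
  using loop_points_nonempty loop_points_subset loop_through_eq by (metis ex_in_conv subsetD)

end

definition diag_point :: "nat \<Rightarrow> nat list set set \<Rightarrow> (nat list set \<Rightarrow> 'x) \<Rightarrow> nat \<Rightarrow> 'x" where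
  "diag_point n \<alpha> y = (\<lambda>i\<in>{1..n}. y (loop_through \<alpha> i))"

lemma diagonal_restrict_eq: "diagonal_restrict n \<alpha> f y = f (diag_point n \<alpha> y)"
  by (simp add: diagonal_restrict_def diag_point_def loop_through_def)

lemma diag_point_power_pts: "diag_point n \<alpha> y \<in> power_pts n"
  by (simp add: diag_point_def)

lemma measurable_diag_point:
  assumes "\<alpha> \<in> loop_collections n"
  shows "diag_point n \<alpha> \<in> measurable (PiM \<alpha> (\<lambda>_. \<sigma>)) (PiM {1..n} (\<lambda>_. \<sigma>))"
  unfolding diag_point_def
  by (intro measurable_restrict measurable_component_singleton loop_through_in[OF assms])

text \<open>
  Every loop passes through some point, so on the diagonal each of the variables indexed by \<open>\<alpha>\<close>
  is tested for membership in \<open>S\<close>.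
\<close>

lemma indicator_power_diag_point:
  assumes "\<alpha> \<in> loop_collections n" "y \<in> extensional \<alpha>"
  shows "indicator_power n S (diag_point n \<alpha> y) = indicator (PiE \<alpha> (\<lambda>_. S)) y"
proof (cases "y \<in> PiE \<alpha> (\<lambda>_. S)")
  case True
  then have "y (loop_through \<alpha> i) \<in> S" if "i \<in> {1..n}" for i
    using loop_through_in[OF assms(1) that] by auto
  then show ?thesis using True by (simp add: indicator_power_def diag_point_def)
next
  case False
  then obtain \<kappa> where \<kappa>: "\<kappa> \<in> \<alpha>" "y \<kappa> \<notin> S" using assms(2) by (auto simp: PiE_iff)
  then obtain i where i: "i \<in> {1..n}" "loop_through \<alpha> i = \<kappa>" using loop_through_surj[OF assms(1)] by blast
  then have "indicator_power n S (diag_point n \<alpha> y) = 0"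
    unfolding indicator_power_def using \<kappa>
    by (intro prod_zero) (auto simp: diag_point_def intro!: bexI[of _ i])
  then show ?thesis using False by simp
qed

section \<open>The norm of the extended Fock space\<close>

definition ext_norm_sq :: "'x measure \<Rightarrow> nat \<Rightarrow> 'x kernel \<Rightarrow> real" where
  "ext_norm_sq \<sigma> n f = (\<Sum>\<alpha>\<in>loop_collections n.
     \<integral>y. (cmod (f (diag_point n \<alpha> y)))\<^sup>2 \<partial>PiM \<alpha> (\<lambda>_. \<sigma>))"

lemma ext_inner_self: "ext_inner \<sigma> n f f = of_real (ext_norm_sq \<sigma> n f)"
proof -
  have "diagonal_restrict n \<alpha> (\<lambda>x. cnj (f x) * f x) =
      (\<lambda>y. complex_of_real ((cmod (f (diag_point n \<alpha> y)))\<^sup>2))" for \<alpha>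
    by (simp only: fun_eq_iff diagonal_restrict_eq complex_norm_square mult.commute) simp
  then show ?thesis
    by (simp only: ext_inner_def ext_norm_sq_def of_real_sum integral_complex_of_real)
qed

lemma ext_norm_eq: "ext_norm \<sigma> n f = sqrt (ext_norm_sq \<sigma> n f)"
  by (simp add: ext_norm_def ext_inner_self)

lemma ext_square_integrable_iff:
  "ext_square_integrable \<sigma> n f \<longleftrightarrow> f \<in> borel_measurable (PiM {1..n} (\<lambda>_. \<sigma>)) \<and>
     (\<forall>\<alpha>\<in>loop_collections n. integrable (PiM \<alpha> (\<lambda>_. \<sigma>)) (\<lambda>y. (cmod (f (diag_point n \<alpha> y)))\<^sup>2))"
proof -
  have "diagonal_restrict n \<alpha> (\<lambda>x. complex_of_real ((cmod (f x))\<^sup>2)) =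
      (\<lambda>y. complex_of_real ((cmod (f (diag_point n \<alpha> y)))\<^sup>2))" for \<alpha>
    by (rule ext) (rule diagonal_restrict_eq)
  then show ?thesis by (simp only: ext_square_integrable_def complex_of_real_integrable_eq)
qed

lemma ext_square_integrable_scale:
  assumes "ext_square_integrable \<sigma> n f"
  shows "ext_square_integrable \<sigma> n (\<lambda>x. a * f x)"
  using assms by (auto simp: ext_square_integrable_iff norm_mult power_mult_distrib)

lemma ext_norm_sq_scale: "ext_norm_sq \<sigma> n (\<lambda>x. a * f x) = (cmod a)\<^sup>2 * ext_norm_sq \<sigma> n f"
  by (simp add: ext_norm_sq_def norm_mult power_mult_distrib sum_distrib_left)

lemma norm_add_sq_le: "(norm (a + b))\<^sup>2 \<le> 2 * (norm a)\<^sup>2 + 2 * (norm b)\<^sup>2"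
proof -
  have "(norm (a + b))\<^sup>2 \<le> (norm a + norm b)\<^sup>2"
    by (intro power_mono norm_triangle_ineq) simp
  also have "\<dots> \<le> 2 * (norm a)\<^sup>2 + 2 * (norm b)\<^sup>2"
    using sum_squares_bound[of "norm a" "norm b"] by (simp add: power2_sum)
  finally show ?thesis .
qed

lemma measurable_sq_diag:
  assumes "f \<in> borel_measurable (PiM {1..n} (\<lambda>_. \<sigma>))" "\<alpha> \<in> loop_collections n"
  shows "(\<lambda>y. (cmod (f (diag_point n \<alpha> y)))\<^sup>2) \<in> borel_measurable (PiM \<alpha> (\<lambda>_. \<sigma>))"
proof -
  have "(\<lambda>y. f (diag_point n \<alpha> y)) \<in> borel_measurable (PiM \<alpha> (\<lambda>_. \<sigma>))"
    by (rule measurable_compose[OF measurable_diag_point[OF assms(2)] assms(1)])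
  then show ?thesis by measurable
qed

lemma ext_square_integrable_add:
  assumes f: "ext_square_integrable \<sigma> n f" and g: "ext_square_integrable \<sigma> n g"
  shows "ext_square_integrable \<sigma> n (\<lambda>x. f x + g x)"
  unfolding ext_square_integrable_iff
proof (intro conjI ballI)
  show meas: "(\<lambda>x. f x + g x) \<in> borel_measurable (PiM {1..n} (\<lambda>_. \<sigma>))"
    using f g by (auto simp: ext_square_integrable_def)
  fix \<alpha> assume \<alpha>: "\<alpha> \<in> loop_collections n"
  have "integrable (PiM \<alpha> (\<lambda>_. \<sigma>))
      (\<lambda>y. 2 * (cmod (f (diag_point n \<alpha> y)))\<^sup>2 + 2 * (cmod (g (diag_point n \<alpha> y)))\<^sup>2)"
    using f g \<alpha> by (intro Bochner_Integration.integrable_add integrable_mult_right)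
      (auto simp: ext_square_integrable_iff)
  then show "integrable (PiM \<alpha> (\<lambda>_. \<sigma>)) (\<lambda>y. (cmod (f (diag_point n \<alpha> y) + g (diag_point n \<alpha> y)))\<^sup>2)"
    by (rule Bochner_Integration.integrable_bound[OF _ measurable_sq_diag[OF meas \<alpha>]])
       (auto intro: order_trans[OF norm_add_sq_le])
qed

lemma ext_norm_sq_add_le:
  assumes f: "ext_square_integrable \<sigma> n f" and g: "ext_square_integrable \<sigma> n g"
  shows "ext_norm_sq \<sigma> n (\<lambda>x. f x + g x) \<le> 2 * ext_norm_sq \<sigma> n f + 2 * ext_norm_sq \<sigma> n g"
proof -
  have "ext_norm_sq \<sigma> n (\<lambda>x. f x + g x) \<le> (\<Sum>\<alpha>\<in>loop_collections n. \<integral>y. 2 * (cmod (f (diag_point n \<alpha> y)))\<^sup>2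
     + 2 * (cmod (g (diag_point n \<alpha> y)))\<^sup>2 \<partial>PiM \<alpha> (\<lambda>_. \<sigma>))"
    unfolding ext_norm_sq_def
  proof (intro sum_mono integral_mono norm_add_sq_le Bochner_Integration.integrable_add integrable_mult_right)
    fix \<alpha> assume "\<alpha> \<in> loop_collections n"
    then show "integrable (PiM \<alpha> (\<lambda>_. \<sigma>)) (\<lambda>y. (cmod (f (diag_point n \<alpha> y) + g (diag_point n \<alpha> y)))\<^sup>2)"
      "integrable (PiM \<alpha> (\<lambda>_. \<sigma>)) (\<lambda>y. (cmod (f (diag_point n \<alpha> y)))\<^sup>2)"
      "integrable (PiM \<alpha> (\<lambda>_. \<sigma>)) (\<lambda>y. (cmod (g (diag_point n \<alpha> y)))\<^sup>2)"
      using f g ext_square_integrable_add[OF f g] by (auto simp: ext_square_integrable_iff)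
  qed
  also have "\<dots> = (\<Sum>\<alpha>\<in>loop_collections n. 2 * (\<integral>y. (cmod (f (diag_point n \<alpha> y)))\<^sup>2 \<partial>PiM \<alpha> (\<lambda>_. \<sigma>))
     + 2 * (\<integral>y. (cmod (g (diag_point n \<alpha> y)))\<^sup>2 \<partial>PiM \<alpha> (\<lambda>_. \<sigma>)))"
    using f g by (intro sum.cong refl, subst Bochner_Integration.integral_add)
      (auto simp: ext_square_integrable_iff)
  also have "\<dots> = 2 * ext_norm_sq \<sigma> n f + 2 * ext_norm_sq \<sigma> n g"
    by (simp add: ext_norm_sq_def sum.distrib sum_distrib_left)
  finally show ?thesis .
qed

section \<open>Radon measures on manifolds\<close>

text \<open>
  The part of the assumptions on the manifold and the measure that gives \<open>\<sigma>\<close>-finiteness, hence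
  well-behaved product measures, and enough test functions.
\<close>

locale radon_manifold =
  fixes A :: "('x::{t2_space, second_countable_topology}, 'd::finite) chart set" and \<sigma> :: "'x measure"
  assumes atlas: "smooth_atlas A" and radon: "radon_measure \<sigma>"
begin

lemma sets_\<sigma> [measurable_cong]: "sets \<sigma> = sets borel"
  using radon by (simp add: radon_measure_def)

lemma space_\<sigma> [simp]: "space \<sigma> = UNIV"
  using sets_eq_imp_space_eq[OF sets_\<sigma>] by simp

lemma compact_finite_measure: "compact K \<Longrightarrow> K \<in> sets \<sigma> \<and> emeasure \<sigma> K < \<infinity>"
  using radon by (auto simp: radon_measure_def compact_imp_closed)

text \<open>
  Manifolds are locally compact, and Radon measures are finite on compact sets.
\<close>

lemma finite_measure_nbhd: "\<exists>W. open W \<and> p \<in> W \<and> emeasure \<sigma> W < \<infinity>"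
proof -
  obtain c where c: "c \<in> A" "p \<in> fst c" using smooth_atlas_cover[OF atlas] .
  note ch = smooth_atlas_chart[OF atlas c(1)]
  obtain r where r: "r > 0" "cball (snd c p) r \<subseteq> snd c ` fst c"
    using ch(2) c(2) by (meson open_contains_cball imageI)
  define W where "W = snd c -` ball (snd c p) r \<inter> fst c"
  define K where "K = chart_inv c ` cball (snd c p) r"
  have "open W"
    using ch(1) homeomorphism_cont1[OF ch(3)] unfolding W_def
    by (metis continuous_on_open_vimage open_ball)
  moreover have "p \<in> W" using c(2) r(1) by (simp add: W_def)
  moreover have "compact K"
    unfolding K_def
    by (rule compact_continuous_image[OF continuous_on_subset[OF homeomorphism_cont2[OF ch(3)] r(2)] compact_cball])
  moreover have "W \<subseteq> K"
  proof
    fix q assume "q \<in> W"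
    then have "q = chart_inv c (snd c q)" "snd c q \<in> cball (snd c p) r"
      using ch(4)[of q] by (auto simp: W_def)
    then show "q \<in> K" unfolding K_def by (rule image_eqI)
  qed
  ultimately show ?thesis
    using compact_finite_measure[of K] emeasure_mono[of W K \<sigma>] by (metis order_le_less_trans)
qed

lemma sigma_finite_\<sigma>: "sigma_finite_measure \<sigma>"
proof
  define F where "F = {W. open W \<and> emeasure \<sigma> W < \<infinity>}"
  have "open W" if "W \<in> F" for W using that by (simp add: F_def)
  then obtain F' where F': "F' \<subseteq> F" "countable F'" "\<Union>F' = \<Union>F" by (rule Lindelof[of F])
  have "\<Union>F = UNIV" using finite_measure_nbhd unfolding F_def by blast
  with F' have "\<Union>F' = space \<sigma>" by simp
  have "W \<in> sets \<sigma> \<and> emeasure \<sigma> W \<noteq> \<infinity>" if "W \<in> F'" for W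
  proof -
    have "open W" "emeasure \<sigma> W < \<infinity>" using subsetD[OF F'(1) that] by (simp_all add: F_def)
    then show ?thesis by (simp add: sets_\<sigma>)
  qed
  then have "F' \<subseteq> sets \<sigma>" "\<forall>a\<in>F'. emeasure \<sigma> a \<noteq> \<infinity>" by (simp_all add: subset_iff)
  with F'(2) \<open>\<Union>F' = space \<sigma>\<close>
  show "\<exists>B. countable B \<and> B \<subseteq> sets \<sigma> \<and> \<Union> B = space \<sigma> \<and> (\<forall>a\<in>B. emeasure \<sigma> a \<noteq> \<infinity>)"
    by (intro exI[of _ F'] conjI)
qed

lemma integrable_box:
  assumes "finite \<alpha>" "S \<in> sets \<sigma>" "emeasure \<sigma> S < \<infinity>"
  shows "integrable (PiM \<alpha> (\<lambda>_. \<sigma>)) (indicator (PiE \<alpha> (\<lambda>_. S)) :: _ \<Rightarrow> real)"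
proof -
  interpret product_sigma_finite "\<lambda>_. \<sigma>"
    by (simp add: product_sigma_finite_def sigma_finite_\<sigma>)
  have "emeasure (PiM \<alpha> (\<lambda>_. \<sigma>)) (PiE \<alpha> (\<lambda>_. S)) = (\<Prod>i\<in>\<alpha>. emeasure \<sigma> S)"
    using assms by (intro emeasure_PiM) auto
  also have "\<dots> < \<infinity>" using assms(3) by (simp add: power_less_top_ennreal)
  finally show ?thesis
    using assms by (intro integrable_real_indicator sets_PiM_I_finite) auto
qed

text \<open>
  A kernel dominated by a multiple of \<open>\<chi>\<^sub>S\<^sup>\<otimes>\<^sup>n\<close>. On every diagonal such a kernel is bounded and supported in a box
  \<open>S\<^sup>\<alpha>\<close> of finite measure if \<open>\<sigma>(S)\<close> is finite, which is what dominated convergence asks for.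
\<close>

definition sub_box :: "nat \<Rightarrow> real \<Rightarrow> 'x set \<Rightarrow> 'x kernel \<Rightarrow> bool" where
  "sub_box n b S f \<longleftrightarrow> (\<forall>x\<in>power_pts n. cmod (f x) \<le> b * cmod (indicator_power n S x))"

lemma sub_box_diag:
  assumes "sub_box n b S f" "\<alpha> \<in> loop_collections n" "y \<in> space (PiM \<alpha> (\<lambda>_. \<sigma>))"
  shows "(cmod (f (diag_point n \<alpha> y)))\<^sup>2 \<le> b\<^sup>2 * indicator (PiE \<alpha> (\<lambda>_. S)) y"
proof -
  have y: "y \<in> extensional \<alpha>" using assms(3) by (simp add: space_PiM PiE_iff)
  have ind: "cmod (indicator_power n S (diag_point n \<alpha> y)) = indicator (PiE \<alpha> (\<lambda>_. S)) y"
    unfolding indicator_power_diag_point[OF assms(2) y] by (simp add: indicator_def)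
  have "cmod (f (diag_point n \<alpha> y)) \<le> b * cmod (indicator_power n S (diag_point n \<alpha> y))"
    using assms(1) diag_point_power_pts unfolding sub_box_def by (rule bspec)
  then have "(cmod (f (diag_point n \<alpha> y)))\<^sup>2 \<le> (b * indicator (PiE \<alpha> (\<lambda>_. S)) y)\<^sup>2"
    unfolding ind by (rule power_mono) simp
  also have "\<dots> = b\<^sup>2 * indicator (PiE \<alpha> (\<lambda>_. S)) y"
    by (cases "y \<in> PiE \<alpha> (\<lambda>_. S)") simp_all
  finally show ?thesis .
qed

lemma sub_box_square_integrable:
  assumes "f \<in> borel_measurable (PiM {1..n} (\<lambda>_. \<sigma>))" "sub_box n b S f"
    "S \<in> sets \<sigma>" "emeasure \<sigma> S < \<infinity>"
  shows "ext_square_integrable \<sigma> n f"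
  unfolding ext_square_integrable_iff
proof (intro conjI ballI assms(1))
  fix \<alpha> assume \<alpha>: "\<alpha> \<in> loop_collections n"
  have "integrable (PiM \<alpha> (\<lambda>_. \<sigma>)) (\<lambda>y. b\<^sup>2 * indicator (PiE \<alpha> (\<lambda>_. S)) y :: real)"
    by (intro integrable_mult_right integrable_box finite_loop_collection[OF \<alpha>] assms)
  then show "integrable (PiM \<alpha> (\<lambda>_. \<sigma>)) (\<lambda>y. (cmod (f (diag_point n \<alpha> y)))\<^sup>2)"
    by (rule Bochner_Integration.integrable_bound[OF _ measurable_sq_diag[OF assms(1) \<alpha>]])
       (auto intro!: AE_I2 sub_box_diag[OF assms(2) \<alpha>])
qed

lemma ext_norm_sq_dominated_convergence:
  assumes meas: "\<And>k. f k \<in> borel_measurable (PiM {1..n} (\<lambda>_. \<sigma>))"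
    and bd: "\<And>k. sub_box n b S (f k)" and S: "S \<in> sets \<sigma>" "emeasure \<sigma> S < \<infinity>"
    and lim: "\<And>x. x \<in> power_pts n \<Longrightarrow> (\<lambda>k. f k x) \<longlonglongrightarrow> 0"
  shows "(\<lambda>k. ext_norm_sq \<sigma> n (f k)) \<longlonglongrightarrow> 0"
proof -
  have "(\<lambda>k. \<integral>y. (cmod (f k (diag_point n \<alpha> y)))\<^sup>2 \<partial>PiM \<alpha> (\<lambda>_. \<sigma>)) \<longlonglongrightarrow> (\<integral>y. 0 \<partial>PiM \<alpha> (\<lambda>_. \<sigma>))"
    if \<alpha>: "\<alpha> \<in> loop_collections n" for \<alpha>
  proof (rule integral_dominated_convergence)
    show "integrable (PiM \<alpha> (\<lambda>_. \<sigma>)) (\<lambda>y. b\<^sup>2 * indicator (PiE \<alpha> (\<lambda>_. S)) y :: real)"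
      by (intro integrable_mult_right integrable_box finite_loop_collection[OF \<alpha>] S)
    show "AE y in PiM \<alpha> (\<lambda>_. \<sigma>). (\<lambda>k. (cmod (f k (diag_point n \<alpha> y)))\<^sup>2) \<longlonglongrightarrow> 0"
    proof (rule AE_I2)
      fix y
      have "(\<lambda>k. (cmod (f k (diag_point n \<alpha> y)))\<^sup>2) \<longlonglongrightarrow> (cmod 0)\<^sup>2"
        by (intro tendsto_intros lim diag_point_power_pts)
      then show "(\<lambda>k. (cmod (f k (diag_point n \<alpha> y)))\<^sup>2) \<longlonglongrightarrow> 0" by simp
    qed
    show "AE y in PiM \<alpha> (\<lambda>_. \<sigma>). norm ((cmod (f k (diag_point n \<alpha> y)))\<^sup>2) \<le> b\<^sup>2 * indicator (PiE \<alpha> (\<lambda>_. S)) y" for k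
      using sub_box_diag[OF bd \<alpha>] by (intro AE_I2) simp
  qed (use measurable_sq_diag[OF meas \<alpha>] in auto)
  then have "(\<lambda>k. ext_norm_sq \<sigma> n (f k)) \<longlonglongrightarrow> (\<Sum>\<alpha>\<in>loop_collections n. \<integral>y. 0 \<partial>PiM \<alpha> (\<lambda>_. \<sigma>))"
    unfolding ext_norm_sq_def by (rule tendsto_sum)
  then show ?thesis by simp
qed

end

section \<open>Finite vectors of the extended Fock space\<close>

context radon_manifold
begin

text \<open>
  The symmetric kernels in the algebraic tensor power. They replace general test kernels as approximants
  because their square integrability and their stability under linear operations
  come from those of products of functions of one variable. A list of summands makes sums and
  multiples immediate.
\<close>

definition elem_kernel :: "nat \<Rightarrow> 'x kernel \<Rightarrow> bool" where
  "elem_kernel n f \<longleftrightarrow> sym_kernel n f \<and>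
     (\<exists>l. (\<forall>p\<in>set l. \<forall>i\<in>{1..n}. snd p i \<in> test_funs A) \<and>
          f = (\<lambda>x. \<Sum>p\<leftarrow>l. fst p * prod_kernel n (snd p) x))"

lemma elem_kernelI:
  assumes "sym_kernel n f" "\<And>p i. p \<in> set l \<Longrightarrow> i \<in> {1..n} \<Longrightarrow> snd p i \<in> test_funs A"
    "f = (\<lambda>x. \<Sum>p\<leftarrow>l. fst p * prod_kernel n (snd p) x)"
  shows "elem_kernel n f"
  unfolding elem_kernel_def by (intro conjI exI[of _ l] ballI assms)

lemma elem_kernel_sym: "elem_kernel n f \<Longrightarrow> sym_kernel n f"
  by (simp add: elem_kernel_def)

lemma elem_kernel_test: "elem_kernel n f \<Longrightarrow> f \<in> test_kernels A n"
proof -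
  assume f: "elem_kernel n f"
  then obtain l where l: "\<And>p i. p \<in> set l \<Longrightarrow> i \<in> {1..n} \<Longrightarrow> snd p i \<in> test_funs A"
    "f = (\<lambda>x. \<Sum>p\<leftarrow>l. fst p * prod_kernel n (snd p) x)" unfolding elem_kernel_def by blast
  show ?thesis
  proof (rule test_kernelsI[OF atlas, where S = "{0..<length l}" and a = "\<lambda>s. fst (l ! s)" and g = "\<lambda>s. snd (l ! s)"])
    show "sym_kernel n f" using f by (simp add: elem_kernel_def)
    show "f x = (\<Sum>s = 0..<length l. fst (l ! s) * prod_kernel n (snd (l ! s)) x)" for x
      by (simp add: l(2) sum_list_sum_nth)
    show "snd (l ! s) i \<in> test_funs A" if "s \<in> {0..<length l}" "i \<in> {1..n}" for s i
      using that(1) by (intro l(1)[OF _ that(2)]) simp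
  qed simp
qed

lemma sym_kernel_add: "sym_kernel n f \<Longrightarrow> sym_kernel n g \<Longrightarrow> sym_kernel n (\<lambda>x. f x + g x)"
  by (simp add: sym_kernel_def)

lemma sym_kernel_scale: "sym_kernel n f \<Longrightarrow> sym_kernel n (\<lambda>x. a * f x)"
  by (simp add: sym_kernel_def)

lemma elem_kernel_add:
  assumes "elem_kernel n f" "elem_kernel n g"
  shows "elem_kernel n (\<lambda>x. f x + g x)"
proof -
  obtain l where l: "\<forall>p\<in>set l. \<forall>i\<in>{1..n}. snd p i \<in> test_funs A"
    "f = (\<lambda>x. \<Sum>p\<leftarrow>l. fst p * prod_kernel n (snd p) x)" using assms(1) unfolding elem_kernel_def by blast
  obtain l' where l': "\<forall>p\<in>set l'. \<forall>i\<in>{1..n}. snd p i \<in> test_funs A"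
    "g = (\<lambda>x. \<Sum>p\<leftarrow>l'. fst p * prod_kernel n (snd p) x)" using assms(2) unfolding elem_kernel_def by blast
  have 1: "\<forall>p\<in>set (l @ l'). \<forall>i\<in>{1..n}. snd p i \<in> test_funs A" using l(1) l'(1) by (simp add: ball_Un)
  have 2: "(\<lambda>x. f x + g x) = (\<lambda>x. \<Sum>p\<leftarrow>l @ l'. fst p * prod_kernel n (snd p) x)"
    by (simp add: l(2) l'(2))
  show ?thesis
    by (rule elem_kernelI[where l = "l @ l'", OF sym_kernel_add[OF assms[THEN elem_kernel_sym]], OF _ 2]) (use 1 in blast)
qed

lemma elem_kernel_scale:
  assumes "elem_kernel n f"
  shows "elem_kernel n (\<lambda>x. a * f x)"
proof -
  obtain l where l: "\<forall>p\<in>set l. \<forall>i\<in>{1..n}. snd p i \<in> test_funs A"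
    "f = (\<lambda>x. \<Sum>p\<leftarrow>l. fst p * prod_kernel n (snd p) x)" using assms(1) unfolding elem_kernel_def by blast
  have 1: "\<forall>p\<in>set (map (\<lambda>p. (a * fst p, snd p)) l). \<forall>i\<in>{1..n}. snd p i \<in> test_funs A"
    using l(1) by simp
  have 2: "(\<lambda>x. a * f x) = (\<lambda>x. \<Sum>p\<leftarrow>map (\<lambda>p. (a * fst p, snd p)) l. fst p * prod_kernel n (snd p) x)"
    by (simp add: l(2) comp_def mult.assoc flip: sum_list_const_mult)
  show ?thesis
    by (rule elem_kernelI[where l = "map (\<lambda>p. (a * fst p, snd p)) l",
          OF sym_kernel_scale[OF assms[THEN elem_kernel_sym]], OF _ 2]) (use 1 in blast)
qed

lemma elem_kernel_symmetrize:
  assumes "\<And>i. i \<in> {1..n} \<Longrightarrow> g i \<in> test_funs A"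
  shows "elem_kernel n (symmetrize n (prod_kernel n g))"
proof -
  have "finite {\<pi>. \<pi> permutes {1..n}}" by (rule finite_permutations) simp
  then obtain ps where ps: "set ps = {\<pi>. \<pi> permutes {1..n}}" "distinct ps"
    using finite_distinct_list by blast
  define l where "l = map (\<lambda>\<pi>. (1 / of_nat (fact n) :: complex, \<lambda>i. g (inv \<pi> i))) ps"
  have 1: "\<forall>p\<in>set l. \<forall>i\<in>{1..n}. snd p i \<in> test_funs A"
    using assms by (auto simp: l_def ps permutes_in_image permutes_inv simp del: atLeastAtMost_iff)
  have 2: "symmetrize n (prod_kernel n g) = (\<lambda>x. \<Sum>p\<leftarrow>l. fst p * prod_kernel n (snd p) x)"
    by (simp only: fun_eq_iff symmetrize_prod_kernel ps(1)[symmetric] l_def map_map comp_def fst_conv snd_conv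
        sum_list_distinct_conv_sum_set[OF ps(2)]) simp
  show ?thesis
    by (rule elem_kernelI[where l = l, OF sym_kernel_symmetrize, OF _ 2]) (use 1 in blast)
qed

lemma test_fun_measurable: "g \<in> test_funs A \<Longrightarrow> g \<in> borel_measurable borel"
  by (intro borel_measurable_continuous_onI smooth_map_continuous[OF atlas] test_funs_smooth)

lemma prod_kernel_measurable:
  assumes "\<And>i. i \<in> {1..n} \<Longrightarrow> g i \<in> borel_measurable borel"
  shows "prod_kernel n g \<in> borel_measurable (PiM {1..n} (\<lambda>_. \<sigma>))"
  unfolding prod_kernel_def[abs_def]
proof (rule borel_measurable_prod)
  fix i assume i: "i \<in> {1..n}"
  have "g i \<in> borel_measurable \<sigma>" using assms[OF i] by (simp add: measurable_cong_sets[OF sets_\<sigma> refl])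
  from measurable_compose[OF measurable_component_singleton[OF i] this]
  show "(\<lambda>x. complex_of_real (g i (x i))) \<in> borel_measurable (PiM {1..n} (\<lambda>_. \<sigma>))"
    by measurable
qed

lemma cmod_prod_kernel_le:
  assumes "\<And>i y. i \<in> {1..n} \<Longrightarrow> \<bar>g i y\<bar> \<le> b i * indicator S y"
  shows "cmod (prod_kernel n g x) \<le> (\<Prod>i\<in>{1..n}. b i) * cmod (indicator_power n S x)"
proof -
  have "cmod (prod_kernel n g x) = (\<Prod>i\<in>{1..n}. \<bar>g i (x i)\<bar>)"
    by (simp add: prod_kernel_def flip: prod_norm)
  also have "\<dots> \<le> (\<Prod>i\<in>{1..n}. b i * indicator S (x i))"
    by (intro prod_mono conjI assms) auto
  also have "\<dots> = (\<Prod>i\<in>{1..n}. b i) * cmod (indicator_power n S x)"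
    by (simp add: indicator_power_eq prod_kernel_def prod.distrib flip: prod_norm)
  finally show ?thesis .
qed

lemma prod_kernel_square_integrable:
  assumes g: "\<And>i. i \<in> {1..n} \<Longrightarrow> g i \<in> test_funs A"
  shows "ext_square_integrable \<sigma> n (prod_kernel n g)"
proof -
  define K where "K = (\<Union>i\<in>{1..n}. closure {x. g i x \<noteq> 0})"
  have cK: "compact K" unfolding K_def using g by (intro compact_UN) (auto simp: test_funs_def)
  have "\<exists>b. \<forall>y. \<bar>g i y\<bar> \<le> b * indicator K y" if i: "i \<in> {1..n}" for i
  proof -
    have "compact (g i ` K)"
      using smooth_map_continuous[OF atlas test_funs_smooth[OF g[OF i]]]
      by (intro compact_continuous_image[OF _ cK]) (rule continuous_on_subset, auto)
    then obtain b where b: "\<And>y. y \<in> K \<Longrightarrow> \<bar>g i y\<bar> \<le> b"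
      using compact_imp_bounded[of "g i ` K"] by (auto simp: bounded_iff)
    have "g i y = 0" if "y \<notin> K" for y
      using that i closure_subset[of "{x. g i x \<noteq> 0}"] unfolding K_def by blast
    then have "\<bar>g i y\<bar> \<le> b * indicator K y" for y using b by (cases "y \<in> K") auto
    then show ?thesis by blast
  qed
  then obtain b where b: "\<And>i y. i \<in> {1..n} \<Longrightarrow> \<bar>g i y\<bar> \<le> b i * indicator K y" by metis
  show ?thesis
  proof (rule sub_box_square_integrable)
    show "prod_kernel n g \<in> borel_measurable (PiM {1..n} (\<lambda>_. \<sigma>))"
      by (intro prod_kernel_measurable test_fun_measurable g)
    show "sub_box n (\<Prod>i\<in>{1..n}. b i) K (prod_kernel n g)"
      unfolding sub_box_def by (intro ballI cmod_prod_kernel_le b)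
    show "K \<in> sets \<sigma>" "emeasure \<sigma> K < \<infinity>" using compact_finite_measure[OF cK] by auto
  qed
qed

lemma zero_square_integrable: "ext_square_integrable \<sigma> n (\<lambda>_. 0)"
  by (rule sub_box_square_integrable[where b = 0 and S = "{}"]) (auto simp: sub_box_def)

lemma elem_kernel_square_integrable:
  assumes "elem_kernel n f" shows "ext_square_integrable \<sigma> n f"
proof -
  obtain l where l: "\<forall>p\<in>set l. \<forall>i\<in>{1..n}. snd p i \<in> test_funs A"
    "f = (\<lambda>x. \<Sum>p\<leftarrow>l. fst p * prod_kernel n (snd p) x)" using assms(1) unfolding elem_kernel_def by blast
  from l(1) have "ext_square_integrable \<sigma> n (\<lambda>x. \<Sum>p\<leftarrow>l. fst p * prod_kernel n (snd p) x)"
  proof (induction l)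
    case (Cons p l)
    then have "ext_square_integrable \<sigma> n (\<lambda>x. fst p * prod_kernel n (snd p) x)"
      by (intro ext_square_integrable_scale prod_kernel_square_integrable) simp
    then show ?case using Cons by (simp add: ext_square_integrable_add)
  qed (simp add: zero_square_integrable)
  then show ?thesis by (simp add: l(2))
qed

text \<open>
  The closure of the algebraic symmetric tensors. It is contained in the \<open>n\<close>-particle space and it is
  visibly a linear space, while it still contains all kernels that occur.
\<close>

definition approx_kernels :: "nat \<Rightarrow> 'x kernel set" where
  "approx_kernels n = {f. sym_kernel n f \<and> ext_square_integrable \<sigma> n f \<and>
     (\<forall>e>0. \<exists>g. elem_kernel n g \<and> ext_norm_sq \<sigma> n (\<lambda>x. f x - g x) < e)}"

lemma ext_norm_sq_zero: "ext_norm_sq \<sigma> n (\<lambda>_. 0) = 0"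
  by (simp add: ext_norm_sq_def)

lemma approx_kernels_fock_n: "approx_kernels n \<subseteq> ext_fock_n A \<sigma> n"
proof
  fix f assume f: "f \<in> approx_kernels n"
  have "\<exists>g\<in>test_kernels A n. ext_norm \<sigma> n (\<lambda>x. f x - g x) < e" if "e > 0" for e
  proof -
    have "0 < e\<^sup>2" using that by simp
    then obtain g where g: "elem_kernel n g" "ext_norm_sq \<sigma> n (\<lambda>x. f x - g x) < e\<^sup>2"
      using f unfolding approx_kernels_def by blast
    have "ext_norm \<sigma> n (\<lambda>x. f x - g x) < e"
      using g(2) that unfolding ext_norm_eq by (simp add: real_less_lsqrt)
    then show ?thesis using elem_kernel_test[OF g(1)] by blast
  qed
  then show "f \<in> ext_fock_n A \<sigma> n" using f by (simp add: approx_kernels_def ext_fock_n_def)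
qed

lemma elem_kernel_closure: "elem_kernel n f \<Longrightarrow> f \<in> approx_kernels n"
  unfolding approx_kernels_def
proof (intro CollectI conjI allI impI)
  assume f: "elem_kernel n f"
  then show "sym_kernel n f" by (simp add: elem_kernel_def)
  show "ext_square_integrable \<sigma> n f" using f by (rule elem_kernel_square_integrable)
  show "\<exists>g. elem_kernel n g \<and> ext_norm_sq \<sigma> n (\<lambda>x. f x - g x) < e" if "e > 0" for e
    using that f by (intro exI[of _ f]) (simp add: ext_norm_sq_zero)
qed

lemma square_integrable_diff:
  "ext_square_integrable \<sigma> n f \<Longrightarrow> ext_square_integrable \<sigma> n g \<Longrightarrow> ext_square_integrable \<sigma> n (\<lambda>x. f x - g x)"
  using ext_square_integrable_add[of \<sigma> n f "\<lambda>x. (-1) * g x"] ext_square_integrable_scale[of \<sigma> n g "-1"]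
  by simp

lemma approx_kernels_add:
  assumes f: "f \<in> approx_kernels n" and f': "f' \<in> approx_kernels n"
  shows "(\<lambda>x. f x + f' x) \<in> approx_kernels n"
  unfolding approx_kernels_def
proof (intro CollectI conjI allI impI)
  show "sym_kernel n (\<lambda>x. f x + f' x)" using f f' by (simp add: approx_kernels_def sym_kernel_add)
  have si: "ext_square_integrable \<sigma> n f" "ext_square_integrable \<sigma> n f'"
    using f f' by (simp_all add: approx_kernels_def)
  show "ext_square_integrable \<sigma> n (\<lambda>x. f x + f' x)" by (rule ext_square_integrable_add[OF si])
  fix e :: real assume "e > 0"
  then have "e / 4 > 0" by simp
  obtain g where g: "elem_kernel n g" "ext_norm_sq \<sigma> n (\<lambda>x. f x - g x) < e / 4"
    using f \<open>e / 4 > 0\<close> unfolding approx_kernels_def by blast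
  obtain g' where g': "elem_kernel n g'" "ext_norm_sq \<sigma> n (\<lambda>x. f' x - g' x) < e / 4"
    using f' \<open>e / 4 > 0\<close> unfolding approx_kernels_def by blast
  have "ext_norm_sq \<sigma> n (\<lambda>x. (f x - g x) + (f' x - g' x))
      \<le> 2 * ext_norm_sq \<sigma> n (\<lambda>x. f x - g x) + 2 * ext_norm_sq \<sigma> n (\<lambda>x. f' x - g' x)"
    by (intro ext_norm_sq_add_le square_integrable_diff si elem_kernel_square_integrable g(1) g'(1))
  also have "\<dots> < e" using g(2) g'(2) by simp
  finally have "ext_norm_sq \<sigma> n (\<lambda>x. (f x + f' x) - (g x + g' x)) < e" by (simp add: algebra_simps)
  then show "\<exists>g. elem_kernel n g \<and> ext_norm_sq \<sigma> n (\<lambda>x. f x + f' x - g x) < e"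
    using elem_kernel_add[OF g(1) g'(1)] by blast
qed

lemma approx_kernels_scale:
  assumes f: "f \<in> approx_kernels n"
  shows "(\<lambda>x. a * f x) \<in> approx_kernels n"
  unfolding approx_kernels_def
proof (intro CollectI conjI allI impI)
  show "sym_kernel n (\<lambda>x. a * f x)" using f by (simp add: approx_kernels_def sym_kernel_scale)
  show "ext_square_integrable \<sigma> n (\<lambda>x. a * f x)"
    using f by (intro ext_square_integrable_scale) (simp add: approx_kernels_def)
  fix e :: real assume e: "e > 0"
  define d where "d = e / ((cmod a)\<^sup>2 + 1)"
  have pos: "(cmod a)\<^sup>2 + 1 > 0" by (simp add: add_nonneg_pos)
  have "d > 0" using e pos by (simp add: d_def)
  then obtain g where g: "elem_kernel n g" "ext_norm_sq \<sigma> n (\<lambda>x. f x - g x) < d"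
    using f unfolding approx_kernels_def by blast
  have "ext_norm_sq \<sigma> n (\<lambda>x. a * f x - a * g x) = (cmod a)\<^sup>2 * ext_norm_sq \<sigma> n (\<lambda>x. f x - g x)"
    by (simp add: ext_norm_sq_scale flip: right_diff_distrib)
  also have "\<dots> \<le> (cmod a)\<^sup>2 * d" using g(2) by (intro mult_left_mono) auto
  also have "\<dots> < ((cmod a)\<^sup>2 + 1) * d" using \<open>d > 0\<close> by simp
  also have "\<dots> = e" using pos by (simp add: d_def)
  finally show "\<exists>g. elem_kernel n g \<and> ext_norm_sq \<sigma> n (\<lambda>x. a * f x - g x) < e"
    using elem_kernel_scale[OF g(1), of a] by blast
qed

lemma approx_kernels_zero: "(\<lambda>_. 0) \<in> approx_kernels n"
  by (rule elem_kernel_closure) (auto simp: elem_kernel_def sym_kernel_def intro!: exI[of _ "[]"])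

lemma approx_kernels_if: "(P \<Longrightarrow> f \<in> approx_kernels n) \<Longrightarrow> (\<lambda>x. if P then f x else 0) \<in> approx_kernels n"
  by (cases P) (simp_all add: approx_kernels_zero)

text \<open>
  Finite vectors suffice: the powers \<open>\<chi>\<^sup>\<otimes>\<^sup>n\<close> and the images of powers under the field operator have at
  most three nonzero components. Summability of the norms is then automatic.
\<close>

definition fin_fock :: "'x fock_vec set" where
  "fin_fock = {h. (\<forall>m. h m \<in> approx_kernels m) \<and> (\<exists>N. \<forall>m>N. h m = (\<lambda>_. 0))}"

lemma fin_fock_sub: "fin_fock \<subseteq> ext_fock A \<sigma>"
proof
  fix h assume h: "h \<in> fin_fock"
  then obtain N where N: "\<And>m. m > N \<Longrightarrow> h m = (\<lambda>_. 0)" by (auto simp: fin_fock_def)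
  have "summable (\<lambda>n. (ext_norm \<sigma> n (h n))\<^sup>2 * fact n)"
    by (rule summable_finite[of "{..N}"]) (auto simp: N ext_norm_eq ext_norm_sq_zero not_le)
  then show "h \<in> ext_fock A \<sigma>"
    using h approx_kernels_fock_n by (auto simp: ext_fock_def fin_fock_def)
qed

lemma fin_fock_add:
  assumes "h \<in> fin_fock" "h' \<in> fin_fock"
  shows "(\<lambda>n x. h n x + h' n x) \<in> fin_fock"
proof -
  obtain N where N: "\<And>m. m > N \<Longrightarrow> h m = (\<lambda>_. 0)" using assms(1) by (auto simp: fin_fock_def)
  obtain N' where N': "\<And>m. m > N' \<Longrightarrow> h' m = (\<lambda>_. 0)" using assms(2) by (auto simp: fin_fock_def)
  have "\<forall>m>max N N'. (\<lambda>x. h m x + h' m x) = (\<lambda>_. 0)" by (simp add: N N')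
  moreover have "(\<lambda>x. h m x + h' m x) \<in> approx_kernels m" for m
    using assms by (intro approx_kernels_add) (simp_all add: fin_fock_def)
  ultimately show ?thesis unfolding fin_fock_def by blast
qed

lemma fin_fock_scale:
  assumes "h \<in> fin_fock"
  shows "(\<lambda>n x. a * h n x) \<in> fin_fock"
proof -
  obtain N where N: "\<And>m. m > N \<Longrightarrow> h m = (\<lambda>_. 0)" using assms(1) by (auto simp: fin_fock_def)
  have "\<forall>m>N. (\<lambda>x. a * h m x) = (\<lambda>_. 0)" by (simp add: N)
  moreover have "(\<lambda>x. a * h m x) \<in> approx_kernels m" for m
    using assms by (intro approx_kernels_scale) (simp add: fin_fock_def)
  ultimately show ?thesis unfolding fin_fock_def by blast
qed

lemma fock_embed_fin: "f \<in> approx_kernels n \<Longrightarrow> fock_embed n f \<in> fin_fock"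
  by (auto simp: fin_fock_def fock_embed_def approx_kernels_zero intro!: exI[of _ n])

lemma fock_inner_fin:
  assumes "\<And>m. m > N \<Longrightarrow> h m = (\<lambda>_. 0)"
  shows "fock_inner \<sigma> h h = of_real (\<Sum>m\<le>N. ext_norm_sq \<sigma> m (h m) * fact m)"
proof -
  have "fock_inner \<sigma> h h = (\<Sum>m\<le>N. ext_inner \<sigma> m (h m) (h m) * of_nat (fact m))"
    unfolding fock_inner_def
    by (rule suminf_finite) (auto simp: assms ext_inner_self ext_norm_sq_zero not_le)
  then show ?thesis by (simp add: ext_inner_self)
qed

end

section \<open>Domination of symmetrized products\<close>

context radon_manifold
begin

lemma sub_box_add:
  "sub_box n b S f \<Longrightarrow> sub_box n b' S g \<Longrightarrow> sub_box n (b + b') S (\<lambda>x. f x + g x)"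
  unfolding sub_box_def by (auto simp: distrib_right intro!: order_trans[OF norm_triangle_ineq] add_mono)

lemma sub_box_scale:
  assumes "sub_box n b S f" "cmod a \<le> M" "b \<ge> 0"
  shows "sub_box n (M * b) S (\<lambda>x. a * f x)"
  unfolding sub_box_def
proof
  fix x :: "nat \<Rightarrow> 'x" assume "x \<in> power_pts n"
  then have "cmod (f x) \<le> b * cmod (indicator_power n S x)" using assms(1) by (simp add: sub_box_def)
  then have "cmod a * cmod (f x) \<le> M * (b * cmod (indicator_power n S x))"
    using assms(2,3) by (intro mult_mono) (auto intro: order_trans[OF norm_ge_zero])
  then show "cmod (a * f x) \<le> M * b * cmod (indicator_power n S x)" by (simp add: norm_mult mult.assoc)
qed

lemma sub_box_if:
  assumes "sub_box n b S f" "b \<ge> 0"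
  shows "sub_box n b S (\<lambda>x. if P then f x else 0)"
  using assms by (simp add: sub_box_def)

text \<open>
  Symmetrization averages over permutations of the factors, and each permuted product satisfies the
  same bound.
\<close>

lemma sub_box_symmetrize:
  assumes "\<And>i y. i \<in> {1..n} \<Longrightarrow> \<bar>g i y\<bar> \<le> indicator S y"
  shows "sub_box n 1 S (symmetrize n (prod_kernel n g))"
  unfolding sub_box_def
proof
  fix x :: "nat \<Rightarrow> 'x"
  let ?c = "cmod (indicator_power n S x)"
  have "cmod (symmetrize n (prod_kernel n g) x) \<le> (\<Sum>\<pi> | \<pi> permutes {1..n}. (1 / fact n) * ?c)"
    unfolding symmetrize_prod_kernel
  proof (rule sum_norm_le)
    fix \<pi> assume "\<pi> \<in> {\<pi>. \<pi> permutes {1..n}}"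
    then have "inv \<pi> i \<in> {1..n}" if "i \<in> {1..n}" for i
      using that by (simp add: permutes_in_image permutes_inv del: atLeastAtMost_iff)
    then have "cmod (prod_kernel n (\<lambda>i. g (inv \<pi> i)) x) \<le> ?c"
      using cmod_prod_kernel_le[of n "\<lambda>i. g (inv \<pi> i)" "\<lambda>_. 1" S x] assms by simp
    then show "cmod (1 / of_nat (fact n) * prod_kernel n (\<lambda>i. g (inv \<pi> i)) x) \<le> (1 / fact n) * ?c"
      by (simp add: norm_mult norm_divide divide_right_mono)
  qed
  also have "\<dots> = ?c" by (simp add: card_permutations[where n = n] del: One_nat_def)
  finally show "cmod (symmetrize n (prod_kernel n g) x) \<le> 1 * ?c" by simp
qed

lemma sub_box_power:
  assumes "\<And>y. \<bar>\<xi> y\<bar> \<le> indicator S y"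
  shows "sub_box n 1 S (prod_kernel n (\<lambda>_. \<xi>))"
  using sub_box_symmetrize[of n "\<lambda>_. \<xi>" S] assms by (simp add: symmetrize_power)

lemma symmetrize_tendsto:
  assumes "\<And>i y. i \<in> {1..n} \<Longrightarrow> (\<lambda>k. g k i y) \<longlonglongrightarrow> h i y"
  shows "(\<lambda>k. symmetrize n (prod_kernel n (g k)) x) \<longlonglongrightarrow> symmetrize n (prod_kernel n h) x"
  unfolding symmetrize_prod_kernel prod_kernel_def
proof (intro tendsto_sum tendsto_mult tendsto_const tendsto_prod tendsto_of_real assms)
  fix \<pi> i assume "\<pi> \<in> {\<pi>. \<pi> permutes {1..n}}" "i \<in> {1..n}"
  then show "inv \<pi> i \<in> {1..n}" by (simp add: permutes_in_image permutes_inv del: atLeastAtMost_iff)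
qed

lemma power_tendsto:
  assumes "\<And>y. (\<lambda>k. \<xi> k y) \<longlonglongrightarrow> h y"
  shows "(\<lambda>k. prod_kernel n (\<lambda>_. \<xi> k) x) \<longlonglongrightarrow> prod_kernel n (\<lambda>_. h) x"
  using symmetrize_tendsto[of n "\<lambda>k _. \<xi> k" "\<lambda>_. h" x] assms by (simp add: symmetrize_power)

end

section \<open>Approximating the indicator function\<close>

locale indicator_approximation = radon_manifold A \<sigma>
  for A :: "('x::{t2_space, second_countable_topology}, 'd::finite) chart set" and \<sigma> :: "'x measure" +
  fixes U :: "'x set" and \<xi> :: "nat \<Rightarrow> 'x \<Rightarrow> real"
  assumes U: "U \<in> relatively_compact_open"
    and \<xi>_test: "\<xi> k \<in> test_funs A"
    and \<xi>_nonneg: "0 \<le> \<xi> k x"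
    and \<xi>_le: "\<xi> k x \<le> indicator U x"
    and \<xi>_lim: "(\<lambda>k. \<xi> k x) \<longlonglongrightarrow> indicator U x"
begin

lemma U_sets: "U \<in> sets \<sigma>"
  using U by (simp add: relatively_compact_open_def sets_\<sigma>)

lemma U_finite: "emeasure \<sigma> U < \<infinity>"
proof -
  have "compact (closure U)" using U by (simp add: relatively_compact_open_def)
  from compact_finite_measure[OF this] show ?thesis
    using emeasure_mono[OF closure_subset, of U \<sigma>] by (auto intro: order_le_less_trans)
qed

lemma \<xi>_sq: "0 \<le> \<xi> k x * \<xi> k x" "\<xi> k x * \<xi> k x \<le> indicator U x"
  "(\<lambda>k. \<xi> k x * \<xi> k x) \<longlonglongrightarrow> indicator U x"
proof -
  have "\<xi> k x * \<xi> k x \<le> indicator U x * indicator U x"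
    by (intro mult_mono \<xi>_le \<xi>_nonneg) simp
  then show "\<xi> k x * \<xi> k x \<le> indicator U x" by (cases "x \<in> U") simp_all
  show "(\<lambda>k. \<xi> k x * \<xi> k x) \<longlonglongrightarrow> indicator U x"
    using tendsto_mult[OF \<xi>_lim \<xi>_lim, of x x] by (cases "x \<in> U") simp_all
qed simp

lemma \<xi>_cube: "0 \<le> (\<xi> k x * \<xi> k x) * \<xi> k x" "(\<xi> k x * \<xi> k x) * \<xi> k x \<le> indicator U x"
  "(\<lambda>k. (\<xi> k x * \<xi> k x) * \<xi> k x) \<longlonglongrightarrow> indicator U x"
proof -
  show "0 \<le> (\<xi> k x * \<xi> k x) * \<xi> k x" by (intro mult_nonneg_nonneg \<xi>_nonneg)
  have "(\<xi> k x * \<xi> k x) * \<xi> k x \<le> indicator U x * indicator U x"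
    by (intro mult_mono \<xi>_sq \<xi>_le \<xi>_nonneg) simp
  then show "(\<xi> k x * \<xi> k x) * \<xi> k x \<le> indicator U x" by (cases "x \<in> U") simp_all
  show "(\<lambda>k. (\<xi> k x * \<xi> k x) * \<xi> k x) \<longlonglongrightarrow> indicator U x"
    using tendsto_mult[OF \<xi>_sq(3) \<xi>_lim, of x x] by (cases "x \<in> U") simp_all
qed

lemma \<xi>_sq_test: "(\<lambda>y. \<xi> k y * \<xi> k y) \<in> test_funs A"
  by (intro test_funs_mult atlas \<xi>_test)

lemma \<xi>_cube_test: "(\<lambda>y. (\<xi> k y * \<xi> k y) * \<xi> k y) \<in> test_funs A"
  by (rule test_funs_mult[OF atlas \<xi>_sq_test \<xi>_test])

lemma dominated_integral:
  assumes test: "\<And>k. f k \<in> test_funs A" and "\<And>k x. 0 \<le> f k x" "\<And>k x. f k x \<le> indicator U x"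
    and lim: "\<And>x. (\<lambda>k. f k x) \<longlonglongrightarrow> indicator U x"
  shows "(\<lambda>k. integral\<^sup>L \<sigma> (f k)) \<longlonglongrightarrow> measure \<sigma> U" "\<bar>integral\<^sup>L \<sigma> (f k)\<bar> \<le> measure \<sigma> U"
proof -
  have int: "integrable \<sigma> (indicator U :: 'x \<Rightarrow> real)" using U_sets U_finite by simp
  have meas: "f k \<in> borel_measurable \<sigma>" for k
    using test_fun_measurable[OF test] by (simp add: measurable_cong_sets[OF sets_\<sigma> refl])
  have "(\<lambda>k. integral\<^sup>L \<sigma> (f k)) \<longlonglongrightarrow> integral\<^sup>L \<sigma> (indicator U)"
    by (rule integral_dominated_convergence[where w = "indicator U"])
       (use int meas assms in auto)
  then show "(\<lambda>k. integral\<^sup>L \<sigma> (f k)) \<longlonglongrightarrow> measure \<sigma> U" using U_sets by simp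
  have "integrable \<sigma> (f k)"
    by (rule Bochner_Integration.integrable_bound[OF int meas]) (use assms in auto)
  then have "integral\<^sup>L \<sigma> (f k) \<le> integral\<^sup>L \<sigma> (indicator U)"
    by (intro integral_mono int assms)
  moreover have "0 \<le> integral\<^sup>L \<sigma> (f k)" using assms(2) by (rule Bochner_Integration.integral_nonneg)
  ultimately show "\<bar>integral\<^sup>L \<sigma> (f k)\<bar> \<le> measure \<sigma> U" using U_sets by simp
qed

lemmas \<xi>_integral = dominated_integral[of \<xi>, OF \<xi>_test \<xi>_nonneg \<xi>_le \<xi>_lim]
lemmas \<xi>_sq_integral = dominated_integral[of "\<lambda>k y. \<xi> k y * \<xi> k y", OF \<xi>_sq_test \<xi>_sq]

lemma symmetrize_approx_kernels:
  "(\<And>i. i \<in> {1..n} \<Longrightarrow> g i \<in> test_funs A) \<Longrightarrow> symmetrize n (prod_kernel n g) \<in> approx_kernels n"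
  by (intro elem_kernel_closure elem_kernel_symmetrize)

lemma power_elem_kernel: "elem_kernel n (prod_kernel n (\<lambda>_. \<xi> k))"
  using elem_kernel_symmetrize[of n "\<lambda>_. \<xi> k"] \<xi>_test by (simp add: symmetrize_power)

lemma \<xi>_abs_le: "\<bar>\<xi> k y\<bar> \<le> indicator U y"
  using \<xi>_nonneg \<xi>_le by simp

lemma ext_norm_sq_power_tendsto:
  "(\<lambda>k. ext_norm_sq \<sigma> n (\<lambda>x. prod_kernel n (\<lambda>_. \<xi> k) x - indicator_power n U x)) \<longlonglongrightarrow> 0"
proof (rule ext_norm_sq_dominated_convergence[OF _ _ U_sets U_finite, where b = "1 + 1 * 1"])
  have "(indicator U :: 'x \<Rightarrow> real) \<in> borel_measurable borel" using U_sets by (simp add: sets_\<sigma>)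
  then show "(\<lambda>x. prod_kernel n (\<lambda>_. \<xi> k) x - indicator_power n U x) \<in> borel_measurable (PiM {1..n} (\<lambda>_. \<sigma>))" for k
    unfolding indicator_power_eq
    by (intro borel_measurable_diff prod_kernel_measurable) (simp_all add: test_fun_measurable[OF \<xi>_test])
  have "sub_box n 1 U (indicator_power n U)"
    unfolding indicator_power_eq by (rule sub_box_power) simp
  then have "sub_box n (1 * 1) U (\<lambda>x. (-1) * indicator_power n U x)"
    by (intro sub_box_scale) simp_all
  from sub_box_add[OF sub_box_power[OF \<xi>_abs_le] this]
  show "sub_box n (1 + 1 * 1) U (\<lambda>x. prod_kernel n (\<lambda>_. \<xi> k) x - indicator_power n U x)" for k
    by simp
  show "(\<lambda>k. prod_kernel n (\<lambda>_. \<xi> k) x - indicator_power n U x) \<longlonglongrightarrow> 0" for x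
    unfolding indicator_power_eq by (rule LIM_zero) (rule power_tendsto[of \<xi> "indicator U", OF \<xi>_lim])
qed

lemma indicator_power_approx_kernels: "indicator_power n U \<in> approx_kernels n"
  unfolding approx_kernels_def
proof (intro CollectI conjI allI impI)
  show "sym_kernel n (indicator_power n U)"
    using sym_kernel_symmetrize[of n "prod_kernel n (\<lambda>_. indicator U)"]
    by (simp add: symmetrize_power indicator_power_eq)
  show "ext_square_integrable \<sigma> n (indicator_power n U)"
  proof (rule sub_box_square_integrable[OF _ _ U_sets U_finite])
    have "(indicator U :: 'x \<Rightarrow> real) \<in> borel_measurable borel" using U_sets by (simp add: sets_\<sigma>)
    then show "indicator_power n U \<in> borel_measurable (PiM {1..n} (\<lambda>_. \<sigma>))"
      unfolding indicator_power_eq by (intro prod_kernel_measurable)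
    show "sub_box n 1 U (indicator_power n U)" by (simp add: sub_box_def)
  qed
  fix e :: real assume "e > 0"
  from order_tendstoD(2)[OF ext_norm_sq_power_tendsto this]
  obtain k where "ext_norm_sq \<sigma> n (\<lambda>x. prod_kernel n (\<lambda>_. \<xi> k) x - indicator_power n U x) < e"
    by (auto simp: eventually_sequentially)
  then have "ext_norm_sq \<sigma> n (\<lambda>x. indicator_power n U x - prod_kernel n (\<lambda>_. \<xi> k) x) < e"
    by (simp add: ext_norm_sq_def norm_minus_commute)
  then show "\<exists>g. elem_kernel n g \<and> ext_norm_sq \<sigma> n (\<lambda>x. indicator_power n U x - g x) < e"
    using power_elem_kernel by blast
qed

lemma power_fin: "fock_embed n (prod_kernel n (\<lambda>_. \<xi> k)) \<in> fin_fock"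
  by (intro fock_embed_fin elem_kernel_closure power_elem_kernel)

lemma indicator_power_fin: "fock_embed n (indicator_power n U) \<in> fin_fock"
  by (intro fock_embed_fin indicator_power_approx_kernels)

lemma field_image_large: "m > Suc n \<Longrightarrow> field_image \<sigma> lam f n m = (\<lambda>_. 0)"
  by (simp add: field_image_def fun_eq_iff)

lemma field_image_fin: "field_image \<sigma> lam (\<xi> k) n \<in> fin_fock"
proof -
  have "field_image \<sigma> lam (\<xi> k) n m \<in> approx_kernels m" for m
    unfolding field_image_def[abs_def]
    by (intro approx_kernels_add approx_kernels_if approx_kernels_scale symmetrize_approx_kernels
        elem_kernel_closure[OF power_elem_kernel])
       (simp_all add: \<xi>_test \<xi>_sq_test \<xi>_cube_test)
  then show ?thesis using field_image_large unfolding fin_fock_def by blast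
qed

text \<open>
  The limit of the images of \<open>\<xi>\<^sub>k\<^sup>\<otimes>\<^sup>n\<close>. It is not introduced as the value of the field operator at \<open>\<chi>\<^sup>\<otimes>\<^sup>n\<close>,
  as \<open>\<chi>\<close> lies outside the test functions.
\<close>

definition field_limit :: "real \<Rightarrow> nat \<Rightarrow> 'x fock_vec" where
  "field_limit lam n = field_image \<sigma> lam (indicator U) n"

lemma field_limit_eq:
  "field_limit lam n = (\<lambda>m x.
     fock_embed (Suc n) (indicator_power (Suc n) U) m x
     + (of_real (lam * real n + c_lam lam * measure \<sigma> U) * fock_embed n (indicator_power n U) m x
     + of_real (real n * (real n - 1 + measure \<sigma> U)) * fock_embed (n - 1) (indicator_power (n - 1) U) m x))"
  unfolding field_limit_def by (intro ext) (simp add: field_image_indicator[OF U_sets U_finite] add.assoc)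

lemma field_limit_fin: "field_limit lam n \<in> fin_fock"
  unfolding field_limit_eq by (intro fin_fock_add fin_fock_scale indicator_power_fin)

lemma field_image_tendsto:
  "(\<lambda>k. field_image \<sigma> lam (\<xi> k) n m x) \<longlonglongrightarrow> field_limit lam n m x"
proof -
  have sq: "indicator U y * indicator U y = (indicator U y :: real)" for y by (simp add: indicator_def)
  have int: "integral\<^sup>L \<sigma> (indicator U :: 'x \<Rightarrow> real) = measure \<sigma> U" using U_sets by simp
  have if_lim: "(\<lambda>k. if P then f k else 0) \<longlonglongrightarrow> (if P then l else 0)"
    if "f \<longlonglongrightarrow> l" for P and f :: "nat \<Rightarrow> complex" and l using that by simp
  have head_lim: "(\<lambda>k. (if i = 1 then f k else \<xi> k) y) \<longlonglongrightarrow> (indicator U y :: real)"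
    if "(\<lambda>k. f k y) \<longlonglongrightarrow> indicator U y" for f y and i :: nat
    using that \<xi>_lim by (cases "i = 1") simp_all
  show ?thesis
    unfolding field_limit_def field_image_def sq int if_cancel
    by (intro tendsto_add if_lim tendsto_mult tendsto_const tendsto_of_real power_tendsto
        symmetrize_tendsto \<xi>_lim \<xi>_integral(1) \<xi>_sq_integral(1) head_lim \<xi>_sq(3) \<xi>_cube(3))
qed

text \<open>
  A bound uniform in \<open>k\<close>: each product is at most \<open>\<chi>\<^sup>\<otimes>\<^sup>m\<close> and each integral is at most \<open>\<sigma>(U)\<close>.
\<close>

lemma field_image_sub_box: "\<exists>b. \<forall>k. sub_box m b U (field_image \<sigma> lam (\<xi> k) n m)"
proof -
  have s: "sub_box m 1 U (symmetrize m (prod_kernel m (\<lambda>i. if i = 1 then f k else \<xi> k)))"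
    if "\<And>k y. 0 \<le> f k y" "\<And>k y. f k y \<le> indicator U y" for f k
    by (rule sub_box_symmetrize) (use that \<xi>_abs_le in auto)
  have le: "cmod (of_real (c * a)) \<le> \<bar>c\<bar> * M" if "\<bar>a\<bar> \<le> M" for c a M :: real
    using that by (simp add: norm_mult abs_mult mult_left_mono)
  have "sub_box m ((1 + (\<bar>lam * real n\<bar> * 1 + (\<bar>c_lam lam\<bar> * measure \<sigma> U) * 1))
     + ((\<bar>real n\<bar> * measure \<sigma> U) * 1 + \<bar>real n * (real n - 1)\<bar> * 1)) U (field_image \<sigma> lam (\<xi> k) n m)" for k
    unfolding field_image_def[abs_def]
    by (intro sub_box_add sub_box_if sub_box_scale sub_box_power \<xi>_abs_le s le \<xi>_sq \<xi>_cube
        \<xi>_integral(2) \<xi>_sq_integral(2)) (simp_all del: of_real_mult of_real_diff)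
  then show ?thesis by blast
qed

lemma ext_norm_sq_field_image_tendsto:
  "(\<lambda>k. ext_norm_sq \<sigma> m (\<lambda>x. field_image \<sigma> lam (\<xi> k) n m x - field_limit lam n m x)) \<longlonglongrightarrow> 0"
proof -
  obtain b where b: "\<And>k. sub_box m b U (field_image \<sigma> lam (\<xi> k) n m)"
    using field_image_sub_box by blast
  have lim_b: "sub_box m b U (field_limit lam n m)"
    unfolding sub_box_def
  proof
    fix x :: "nat \<Rightarrow> 'x" assume x: "x \<in> power_pts m"
    show "cmod (field_limit lam n m x) \<le> b * cmod (indicator_power m U x)"
      by (rule Lim_bounded[OF tendsto_norm[OF field_image_tendsto], of 0])
         (use b x in \<open>simp add: sub_box_def\<close>)
  qed
  have diff: "sub_box m (b + b) U (\<lambda>x. field_image \<sigma> lam (\<xi> k) n m x - field_limit lam n m x)" for k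
    unfolding sub_box_def
  proof
    fix x :: "nat \<Rightarrow> 'x" assume x: "x \<in> power_pts m"
    have "cmod (field_image \<sigma> lam (\<xi> k) n m x - field_limit lam n m x)
        \<le> cmod (field_image \<sigma> lam (\<xi> k) n m x) + cmod (field_limit lam n m x)"
      by (rule norm_triangle_ineq4)
    also have "\<dots> \<le> b * cmod (indicator_power m U x) + b * cmod (indicator_power m U x)"
      using b[of k] lim_b x unfolding sub_box_def by (intro add_mono) blast+
    finally show "cmod (field_image \<sigma> lam (\<xi> k) n m x - field_limit lam n m x)
        \<le> (b + b) * cmod (indicator_power m U x)" by (simp add: distrib_right)
  qed
  have meas: "h m \<in> borel_measurable (PiM {1..m} (\<lambda>_. \<sigma>))" if "h \<in> fin_fock" for h
    using that by (simp add: fin_fock_def approx_kernels_def ext_square_integrable_def)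
  show ?thesis
  proof (rule ext_norm_sq_dominated_convergence[OF _ diff U_sets U_finite])
    show "(\<lambda>x. field_image \<sigma> lam (\<xi> k) n m x - field_limit lam n m x) \<in> borel_measurable (PiM {1..m} (\<lambda>_. \<sigma>))" for k
      by (intro borel_measurable_diff meas field_image_fin field_limit_fin)
    show "(\<lambda>k. field_image \<sigma> lam (\<xi> k) n m x - field_limit lam n m x) \<longlonglongrightarrow> 0" for x
      using field_image_tendsto by (rule LIM_zero)
  qed
qed

text \<open>
  The pair lies in the graph of the operator before closure, so the approximating vector is the
  vector itself.
\<close>

lemma power_in_field_op_closure:
  "(fock_embed n (prod_kernel n (\<lambda>_. \<xi> k)), field_image \<sigma> lam (\<xi> k) n) \<in> field_op_closure A \<sigma> lam (\<xi> k)"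
proof -
  have "prod_kernel n (\<lambda>_. \<xi> k) \<in> test_kernels A n" by (intro elem_kernel_test power_elem_kernel)
  then have "fock_embed n (prod_kernel n (\<lambda>_. \<xi> k)) \<in> fock_fin A"
    using zero_test_kernel[OF atlas] by (auto simp: fock_fin_def fock_embed_def intro!: exI[of _ n])
  moreover have "fock_norm \<sigma> (\<lambda>n x. 0) = 0" by (simp add: fock_norm_def ext_norm_eq ext_norm_sq_zero)
  ultimately show ?thesis
    using fin_fock_sub power_fin field_image_fin
    unfolding field_op_closure_def
    by (auto simp: field_op_power intro!: bexI[of _ "fock_embed n (prod_kernel n (\<lambda>_. \<xi> k))"])
qed

end

section \<open>Passing to the spectral representation\<close>

lemma null_integrals_AE_subseq:
  fixes F :: "nat \<Rightarrow> 'w \<Rightarrow> real"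
  assumes "\<And>k. integrable \<mu> (F k)" "\<And>k \<omega>. 0 \<le> F k \<omega>" "(\<lambda>k. integral\<^sup>L \<mu> (F k)) \<longlonglongrightarrow> 0"
  obtains r :: "nat \<Rightarrow> nat" where "strict_mono r" "AE \<omega> in \<mu>. (\<lambda>k. F (r k) \<omega>) \<longlonglongrightarrow> 0"
  using tendsto_L1_AE_subseq[of \<mu> F] assms by auto

text \<open>
  Several sequences are made to converge along one subsequence by adding up their squared errors;
  this recovers the individual limits.
\<close>

lemma sq_bound_tendsto:
  fixes f :: "nat \<Rightarrow> complex"
  assumes "\<And>k. (cmod (f k - l))\<^sup>2 \<le> u k" "u \<longlonglongrightarrow> 0"
  shows "f \<longlonglongrightarrow> l"
proof -
  have "(\<lambda>k. sqrt (u k)) \<longlonglongrightarrow> 0" using tendsto_real_sqrt[OF assms(2)] by simp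
  moreover have "\<forall>k. norm (f k - l) \<le> sqrt (u k)" by (intro allI real_le_rsqrt assms(1))
  then have "\<forall>\<^sub>F k in sequentially. norm (f k - l) \<le> sqrt (u k)" by (rule always_eventually)
  ultimately have "(\<lambda>k. f k - l) \<longlonglongrightarrow> 0" by (rule Lim_null_comparison[rotated])
  then show ?thesis by (rule LIM_zero_cancel)
qed

locale spectral_manifold = radon_manifold A \<sigma>
  for A :: "('x::{t2_space, second_countable_topology}, 'd::finite) chart set" and \<sigma> :: "'x measure" +
  fixes lam :: real and \<mu> :: "(('x \<Rightarrow> real) \<Rightarrow> real) measure"
    and I :: "'x fock_vec \<Rightarrow> (('x \<Rightarrow> real) \<Rightarrow> real) \<Rightarrow> complex"
  assumes spectral: "spectral_pair A \<sigma> lam \<mu> I"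
begin

lemma unitary: "fock_unitary A \<sigma> \<mu> I"
  using spectral by (simp add: spectral_pair_def)

lemma I_add:
  "f \<in> fin_fock \<Longrightarrow> g \<in> fin_fock \<Longrightarrow> AE \<omega> in \<mu>. I (\<lambda>n x. f n x + g n x) \<omega> = I f \<omega> + I g \<omega>"
  using unitary fin_fock_sub unfolding fock_unitary_def by blast

lemma I_scale: "f \<in> fin_fock \<Longrightarrow> AE \<omega> in \<mu>. I (\<lambda>n x. a * f n x) \<omega> = a * I f \<omega>"
  using unitary fin_fock_sub unfolding fock_unitary_def by blast

lemma I_L2: "f \<in> fin_fock \<Longrightarrow> I f \<in> L2_funs \<mu>"
  using unitary fin_fock_sub unfolding fock_unitary_def by blast

lemma I_inner: "f \<in> fin_fock \<Longrightarrow> integral\<^sup>L \<mu> (\<lambda>\<omega>. cnj (I f \<omega>) * I f \<omega>) = fock_inner \<sigma> f f"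
  using unitary fin_fock_sub unfolding fock_unitary_def by blast

lemma fin_fock_diff:
  assumes "f \<in> fin_fock" "g \<in> fin_fock"
  shows "(\<lambda>n x. f n x - g n x) \<in> fin_fock"
  using fin_fock_add[OF assms(1) fin_fock_scale[OF assms(2), of "-1"]] by simp

lemma I_diff:
  assumes "f \<in> fin_fock" "g \<in> fin_fock"
  shows "AE \<omega> in \<mu>. I (\<lambda>n x. f n x - g n x) \<omega> = I f \<omega> - I g \<omega>"
  using I_add[OF assms(1) fin_fock_scale[OF assms(2), of "-1"]] I_scale[OF assms(2), of "-1"]
  by eventually_elim simp

lemma I_lin_comb:
  assumes "f \<in> fin_fock" "g \<in> fin_fock" "h \<in> fin_fock"
  shows "AE \<omega> in \<mu>. I (\<lambda>n x. f n x + (a * g n x + b * h n x)) \<omega> = I f \<omega> + a * I g \<omega> + b * I h \<omega>"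
  using I_add[OF assms(1) fin_fock_add[OF fin_fock_scale[OF assms(2), of a] fin_fock_scale[OF assms(3), of b]]]
    I_add[OF fin_fock_scale[OF assms(2), of a] fin_fock_scale[OF assms(3), of b]]
    I_scale[OF assms(2), of a] I_scale[OF assms(3), of b]
  by eventually_elim simp

text \<open>
  The map \<open>I\<close> acts on representatives, and so it is linear only up to null sets.
  Hence the difference of images has to be compared with the image of the difference almost everywhere.
\<close>

lemma I_isometry:
  assumes f: "f \<in> fin_fock" and g: "g \<in> fin_fock" and N: "\<And>m. m > N \<Longrightarrow> f m = g m"
  shows "integrable \<mu> (\<lambda>\<omega>. (cmod (I f \<omega> - I g \<omega>))\<^sup>2)"
    and "(\<integral>\<omega>. (cmod (I f \<omega> - I g \<omega>))\<^sup>2 \<partial>\<mu>) = (\<Sum>m\<le>N. ext_norm_sq \<sigma> m (\<lambda>x. f m x - g m x) * fact m)"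
proof -
  define D where "D = (\<lambda>n x. f n x - g n x)"
  have D: "D \<in> fin_fock" unfolding D_def by (rule fin_fock_diff[OF f g])
  have [measurable]: "I f \<in> borel_measurable \<mu>" "I g \<in> borel_measurable \<mu>" "I D \<in> borel_measurable \<mu>"
    using I_L2[OF f] I_L2[OF g] I_L2[OF D] by (simp_all add: L2_funs_def)
  have AE: "AE \<omega> in \<mu>. (cmod (I D \<omega>))\<^sup>2 = (cmod (I f \<omega> - I g \<omega>))\<^sup>2"
    using I_diff[OF f g] unfolding D_def by eventually_elim simp
  have "integrable \<mu> (\<lambda>\<omega>. (cmod (I D \<omega>))\<^sup>2)" using I_L2[OF D] by (simp add: L2_funs_def)
  then show "integrable \<mu> (\<lambda>\<omega>. (cmod (I f \<omega> - I g \<omega>))\<^sup>2)"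
    by (rule integrable_cong_AE_imp) (use AE in auto)
  have "complex_of_real (\<integral>\<omega>. (cmod (I D \<omega>))\<^sup>2 \<partial>\<mu>) = integral\<^sup>L \<mu> (\<lambda>\<omega>. complex_of_real ((cmod (I D \<omega>))\<^sup>2))"
    by (simp only: integral_complex_of_real)
  also have "\<dots> = fock_inner \<sigma> D D"
    unfolding I_inner[OF D, symmetric] by (simp only: complex_norm_square mult.commute)
  also have "\<dots> = of_real (\<Sum>m\<le>N. ext_norm_sq \<sigma> m (D m) * fact m)"
    by (rule fock_inner_fin) (simp add: D_def N)
  finally have "(\<integral>\<omega>. (cmod (I D \<omega>))\<^sup>2 \<partial>\<mu>) = (\<Sum>m\<le>N. ext_norm_sq \<sigma> m (D m) * fact m)"
    by (simp only: of_real_eq_iff)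
  moreover have "(\<integral>\<omega>. (cmod (I f \<omega> - I g \<omega>))\<^sup>2 \<partial>\<mu>) = (\<integral>\<omega>. (cmod (I D \<omega>))\<^sup>2 \<partial>\<mu>)"
    by (rule integral_cong_AE) (use AE in auto)
  ultimately show "(\<integral>\<omega>. (cmod (I f \<omega> - I g \<omega>))\<^sup>2 \<partial>\<mu>) = (\<Sum>m\<le>N. ext_norm_sq \<sigma> m (\<lambda>x. f m x - g m x) * fact m)"
    by (simp add: D_def)
qed

lemma I_tendsto_L2:
  assumes "\<And>k. f k \<in> fin_fock" "g \<in> fin_fock" "\<And>k m. m > N \<Longrightarrow> f k m = g m"
    and "\<And>m. (\<lambda>k. ext_norm_sq \<sigma> m (\<lambda>x. f k m x - g m x)) \<longlonglongrightarrow> 0"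
  shows "(\<lambda>k. \<integral>\<omega>. (cmod (I (f k) \<omega> - I g \<omega>))\<^sup>2 \<partial>\<mu>) \<longlonglongrightarrow> 0"
proof -
  have "(\<lambda>k. \<Sum>m\<le>N. ext_norm_sq \<sigma> m (\<lambda>x. f k m x - g m x) * fact m) \<longlonglongrightarrow> (\<Sum>m\<le>N. 0 * fact m)"
    by (intro tendsto_sum tendsto_mult tendsto_const assms(4))
  then show ?thesis by (simp add: I_isometry(2)[OF assms(1-3)])
qed

end

locale spectral_approximation = indicator_approximation A \<sigma> U \<xi> + spectral_manifold A \<sigma> lam \<mu> I
  for A :: "('x::{t2_space, second_countable_topology}, 'd::finite) chart set" and \<sigma> :: "'x measure"
    and U :: "'x set" and \<xi> :: "nat \<Rightarrow> 'x \<Rightarrow> real" and lam :: real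
    and \<mu> :: "(('x \<Rightarrow> real) \<Rightarrow> real) measure"
    and I :: "'x fock_vec \<Rightarrow> (('x \<Rightarrow> real) \<Rightarrow> real) \<Rightarrow> complex"
begin

lemma field_image_AE:
  "AE \<omega> in \<mu>. of_real (\<omega> (\<xi> k)) * I (fock_embed n (prod_kernel n (\<lambda>_. \<xi> k))) \<omega>
     = I (field_image \<sigma> lam (\<xi> k) n) \<omega>"
  using spectral power_in_field_op_closure[of n k lam] fin_fock_sub power_fin[of n k] field_image_fin[of lam k n] \<xi>_test[of k]
  unfolding spectral_pair_def by blast

lemma power_zero_vacuum: "fock_embed 0 (prod_kernel 0 g) = fock_vacuum"
  by (simp add: fock_vacuum_def prod_kernel_def[abs_def])

lemma I_vacuum: "AE \<omega> in \<mu>. I fock_vacuum \<omega> = 1"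
  using spectral by (simp add: spectral_pair_def)

text \<open>
  The product rule \<open>\<langle>\<omega>, \<xi>\<^sub>k\<rangle> I(\<xi>\<^sub>k\<^sup>\<otimes>\<^sup>n) = I(a(\<xi>\<^sub>k) \<xi>\<^sub>k\<^sup>\<otimes>\<^sup>n)\<close> in the limit. The multiplier \<open>\<langle>\<omega>, \<xi>\<^sub>k\<rangle>\<close>
  has no direct limit in terms of \<open>\<omega>\<close>, as \<open>\<chi>\<close> is not a test function. It is therefore rewritten as \<open>I(a(\<xi>\<^sub>k) \<Omega>)\<close>, the
  case \<open>n = 0\<close>, whose limit is \<open>I(\<chi>) + c\<^sub>\<lambda> \<sigma>(U)\<close>.
\<close>

lemma field_limit_product:
  "AE \<omega> in \<mu>. I (field_limit lam 0) \<omega> * I (fock_embed n (indicator_power n U)) \<omega> = I (field_limit lam n) \<omega>"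
proof -
  define F where "F k = fock_embed n (prod_kernel n (\<lambda>_. \<xi> k))" for k
  define F0 where "F0 = fock_embed n (indicator_power n U)"
  define G where "G j k = field_image \<sigma> lam (\<xi> k) j" for j k
  have fin: "F k \<in> fin_fock" "F0 \<in> fin_fock" "G j k \<in> fin_fock" for j k
    unfolding F_def F0_def G_def by (rule power_fin indicator_power_fin field_image_fin)+
  have eqF: "F k m = F0 m" if "m > n" for k m using that by (simp add: F_def F0_def fock_embed_def)
  have eqG: "G j k m = field_limit lam j m" if "m > Suc j" for j k m
    using that by (simp add: G_def field_limit_def field_image_large)
  have "(\<lambda>k. ext_norm_sq \<sigma> m (\<lambda>x. F k m x - F0 m x)) \<longlonglongrightarrow> 0" for m
    using ext_norm_sq_power_tendsto[of n] by (cases "m = n") (simp_all add: F_def F0_def fock_embed_def ext_norm_sq_zero)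
  note LF = I_tendsto_L2[OF fin(1,2) eqF this]
  have "(\<lambda>k. ext_norm_sq \<sigma> m (\<lambda>x. G j k m x - field_limit lam j m x)) \<longlonglongrightarrow> 0" for j m
    unfolding G_def by (rule ext_norm_sq_field_image_tendsto)
  note LG = I_tendsto_L2[OF fin(3) field_limit_fin eqG this]
  note intF = I_isometry(1)[OF fin(1,2) eqF]
  note intG = I_isometry(1)[OF fin(3) field_limit_fin eqG]
  \<comment> \<open>One integrable error for all three sequences, so that a single subsequence serves them all.\<close>
  define u where "u k \<omega> = (cmod (I (F k) \<omega> - I F0 \<omega>))\<^sup>2
      + ((cmod (I (G n k) \<omega> - I (field_limit lam n) \<omega>))\<^sup>2
      + (cmod (I (G 0 k) \<omega> - I (field_limit lam 0) \<omega>))\<^sup>2)" for k \<omega>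
  have int_u: "integrable \<mu> (u k)" for k
    unfolding u_def[abs_def] by (intro Bochner_Integration.integrable_add intF intG)
  have "integral\<^sup>L \<mu> (u k) = (\<integral>\<omega>. (cmod (I (F k) \<omega> - I F0 \<omega>))\<^sup>2 \<partial>\<mu>)
      + ((\<integral>\<omega>. (cmod (I (G n k) \<omega> - I (field_limit lam n) \<omega>))\<^sup>2 \<partial>\<mu>)
      + (\<integral>\<omega>. (cmod (I (G 0 k) \<omega> - I (field_limit lam 0) \<omega>))\<^sup>2 \<partial>\<mu>))" for k
    unfolding u_def[abs_def]
    by (simp only: Bochner_Integration.integral_add Bochner_Integration.integrable_add intF intG)
  then have "(\<lambda>k. integral\<^sup>L \<mu> (u k)) \<longlonglongrightarrow> 0 + (0 + 0)"
    by (simp only:) (intro tendsto_add LF LG)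
  then obtain r where r: "AE \<omega> in \<mu>. (\<lambda>k. u (r k) \<omega>) \<longlonglongrightarrow> 0"
    using null_integrals_AE_subseq[of \<mu> u] int_u by (auto simp: u_def)
  have prod: "AE \<omega> in \<mu>. \<forall>k. I (G 0 k) \<omega> * I (F k) \<omega> = I (G n k) \<omega>"
    unfolding AE_all_countable
  proof
    fix k
    have *: "AE \<omega> in \<mu>. of_real (\<omega> (\<xi> k)) * I fock_vacuum \<omega> = I (G 0 k) \<omega>"
      using field_image_AE[of k 0] by (simp add: power_zero_vacuum G_def)
    show "AE \<omega> in \<mu>. I (G 0 k) \<omega> * I (F k) \<omega> = I (G n k) \<omega>"
      using * field_image_AE[of k n] I_vacuum unfolding F_def[symmetric] G_def[symmetric]
      by eventually_elim auto
  qed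
  show ?thesis
    using r prod
  proof eventually_elim
    case (elim \<omega>)
    have F: "(\<lambda>k. I (F (r k)) \<omega>) \<longlonglongrightarrow> I F0 \<omega>"
      by (rule sq_bound_tendsto[OF _ elim(1)]) (simp add: u_def)
    have Gn: "(\<lambda>k. I (G n (r k)) \<omega>) \<longlonglongrightarrow> I (field_limit lam n) \<omega>"
      by (rule sq_bound_tendsto[OF _ elim(1)]) (simp add: u_def)
    have G0: "(\<lambda>k. I (G 0 (r k)) \<omega>) \<longlonglongrightarrow> I (field_limit lam 0) \<omega>"
      by (rule sq_bound_tendsto[OF _ elim(1)]) (simp add: u_def)
    have "(\<lambda>k. I (G n (r k)) \<omega>) \<longlonglongrightarrow> I (field_limit lam 0) \<omega> * I F0 \<omega>"
      using tendsto_mult[OF G0 F] elim(2) by simp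
    from LIMSEQ_unique[OF this Gn] show ?case by (simp add: F0_def)
  qed
qed

lemma I_field_limit:
  "AE \<omega> in \<mu>. I (field_limit lam n) \<omega> = wick I (Suc n) (indicator_power (Suc n) U) \<omega>
     + of_real (lam * real n + c_lam lam * measure \<sigma> U) * wick I n (indicator_power n U) \<omega>
     + of_real (real n * (real n - 1 + measure \<sigma> U)) * wick I (n - 1) (indicator_power (n - 1) U) \<omega>"
  unfolding field_limit_eq wick_def
  by (rule I_lin_comb) (rule indicator_power_fin)+

lemma wick_zero: "AE \<omega> in \<mu>. wick I 0 (indicator_power 0 U) \<omega> = 1"
  using I_vacuum unfolding wick_def indicator_power_eq power_zero_vacuum .

lemma wick_recurrence:
  "AE \<omega> in \<mu>. pair_indicator I \<sigma> lam U \<omega> * wick I n (indicator_power n U) \<omega> =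
     wick I (Suc n) (indicator_power (Suc n) U) \<omega>
     + of_real (lam * real n + c_lam lam * measure \<sigma> U) * wick I n (indicator_power n U) \<omega>
     + of_real (real n * (real n - 1 + measure \<sigma> U)) * wick I (n - 1) (indicator_power (n - 1) U) \<omega>"
  using field_limit_product[of n] I_field_limit[of n] I_field_limit[of 0] wick_zero
  by eventually_elim (simp add: pair_indicator_def wick_def)

end

section \<open>Evaluation of real polynomials at complex numbers\<close>

lemma poly_of_real_add:
  "poly (map_poly of_real (p + q)) z = poly (map_poly of_real p) z + poly (map_poly of_real q) (z :: complex)"
proof -
  have "map_poly of_real (p + q) = map_poly of_real p + (map_poly of_real q :: complex poly)"
    by (intro poly_eqI) (simp add: coeff_map_poly)
  then show ?thesis by simp
qed

lemma poly_of_real_smult: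
  "poly (map_poly of_real (smult a p)) z = of_real a * poly (map_poly of_real p) (z :: complex)"
  by (simp add: map_poly_smult)

lemma poly_of_real_X:
  "poly (map_poly of_real ([:0, 1:] * p)) z = z * poly (map_poly of_real p) (z :: complex)"
  by (simp add: map_poly_pCons)

theorem corollary2p2:
  fixes A :: "('x::{t2_space, second_countable_topology}, 'd::finite) chart set"
    and G :: "('x, 'd) chart \<Rightarrow> 'x \<Rightarrow> real ^ 'd ^ 'd"
    and \<sigma> :: "'x measure"
    and lam :: real
    and \<mu> :: "(('x \<Rightarrow> real) \<Rightarrow> real) measure"
    and I :: "'x fock_vec \<Rightarrow> (('x \<Rightarrow> real) \<Rightarrow> real) \<Rightarrow> complex"
    and \<Delta> :: "'x set"
    and P :: "int \<Rightarrow> real poly"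
    and n :: nat
  assumes "complete_oriented_riemannian_manifold A G"
    and "connected (UNIV :: 'x set)"
    and "\<not> compact (UNIV :: 'x set)"
    and "radon_measure \<sigma>" and "non_atomic \<sigma>" and "non_degenerate \<sigma>"
    and "lam \<ge> 0"
    and "spectral_pair A \<sigma> lam \<mu> I"
    and "\<Delta> \<in> relatively_compact_open"
    and "P (-1) = 0" and "P 0 = 1"
    and "\<And>m::nat. lead_coeff (P (int m)) = 1"
    and "\<And>m::nat. [:0, 1:] * P (int m) = P (int m + 1)
            + smult (lam * real m + c_lam lam * measure \<sigma> \<Delta>) (P (int m))
            + smult (real m * (real m - 1 + measure \<sigma> \<Delta>)) (P (int m - 1))"
  shows "AE \<omega> in \<mu>. wick I n (indicator_power n \<Delta>) \<omega> =
           poly (map_poly complex_of_real (P (int n))) (pair_indicator I \<sigma> lam \<Delta> \<omega>)"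
proof -
  have atlas: "smooth_atlas A"
    using assms(1) by (simp add: complete_oriented_riemannian_manifold_def oriented_atlas_def)
  obtain \<xi> :: "nat \<Rightarrow> 'x \<Rightarrow> real" where \<xi>: "\<And>k. \<xi> k \<in> test_funs A"
    "\<And>k x. 0 \<le> \<xi> k x" "\<And>k x. \<xi> k x \<le> indicator \<Delta> x" "\<And>x. (\<lambda>k. \<xi> k x) \<longlonglongrightarrow> indicator \<Delta> x"
    using test_funs_approx_indicator[OF atlas assms(9)] by blast
  interpret spectral_approximation A \<sigma> \<Delta> \<xi> lam \<mu> I
    by unfold_locales (fact atlas assms \<xi>)+
  let ?W = "\<lambda>n. wick I n (indicator_power n \<Delta>)"
  let ?X = "pair_indicator I \<sigma> lam \<Delta>"
  define Q where "Q j = (\<lambda>\<omega>. poly (map_poly complex_of_real (P (int j))) (?X \<omega>))" for j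
  have recur: "?X \<omega> * Q j \<omega> = Q (Suc j) \<omega>
     + of_real (lam * real j + c_lam lam * measure \<sigma> \<Delta>) * Q j \<omega>
     + of_real (real j * (real j - 1 + measure \<sigma> \<Delta>)) * Q (j - 1) \<omega>" for j \<omega>
  proof -
    have "?X \<omega> * Q j \<omega> = poly (map_poly complex_of_real ([:0, 1:] * P (int j))) (?X \<omega>)"
      by (simp only: Q_def poly_of_real_X)
    also have "\<dots> = Q (Suc j) \<omega>
       + of_real (lam * real j + c_lam lam * measure \<sigma> \<Delta>) * Q j \<omega>
       + of_real (real j * (real j - 1 + measure \<sigma> \<Delta>)) * poly (map_poly complex_of_real (P (int j - 1))) (?X \<omega>)"
      unfolding assms(13) poly_of_real_add poly_of_real_smult Q_def by (simp add: add.commute)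
    \<comment> \<open>For \<open>j = 0\<close> the index \<open>j - 1\<close> is \<open>-1\<close> as an integer but \<open>0\<close> as a natural number; the coefficient is \<open>0\<close> then.\<close>
    finally show ?thesis by (cases j) (simp_all add: Q_def)
  qed
  have "AE \<omega> in \<mu>. ?W n \<omega> = Q n \<omega>"
  proof (induction n rule: less_induct)
    case (less n)
    show ?case
    proof (cases n)
      case 0
      then show ?thesis using wick_zero by (simp add: Q_def assms(11))
    next
      case (Suc j)
      have "AE \<omega> in \<mu>. ?W j \<omega> = Q j \<omega>" "AE \<omega> in \<mu>. ?W (j - 1) \<omega> = Q (j - 1) \<omega>"
        by (rule less.IH, simp add: Suc)+
      with wick_recurrence[of j] show ?thesis
        unfolding Suc
      proof eventually_elim
        case (elim \<omega>)
        then show ?case using recur[of \<omega> j] by simp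
      qed
    qed
  qed
  then show ?thesis by (simp add: Q_def)
qed

end
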